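(* Swap Bribery for $k$-approval, on instances with $n$ votes and $m$ candidates, can be solved with a randomized algorithm in $2^{2(\log n+\log k)nk}\,O(m^{k+1})$ expected time. The derandomized version of the algorithm is a deterministic algorithm solving the problem with running time $2^{O((\log n+\log k)nk)}\,O(m^{k+1}\log m)$.
   Context: Elections. An election consists of a set $C=\{c_1,\dots,c_m\}$ of candidates and votes $V=\{v_1,\dots,v_n\}$; each vote is a strict linear order over $C$ (several voters may have the same order), and $\mathrm{rank}(c,v)$ is the position of $c$ in $v$ (position $1$ is best). In $k$-approval, a candidate $c$ receives one point from $v$ if $\mathrm{rank}(c,v)\le k$ and zero points otherwise; the winners are all candidates with the highest total number of points (ties are allowed, so there may be several winners). Swaps. A swap in a vote $v$ is a triple $(v,a,b)$ with $a,b\in C$, $a\ne b$. It is admissible in $v$ if $\mathrm{rank}(a,v)=\mathrm{rank}(b,v)-1$; applying it exchanges the positions of $a$ and $b$ in $v$. A set $\Gamma$ of swaps is admissible in $v$ if its elements can be applied to $v$ one after the other in some order, each being admissible in the vote obtained so far; the resulting vote is $v^{\Gamma}$. This extends vote by vote to several votes, the resulting votes being denoted $V^{\Gamma}$. Swap Bribery for an election system $\mathcal{E}$: given an $\mathcal{E}$-election $(C,V)$, a preferred candidate $p\in C$, a cost function assigning to each possible swap in each vote a non-negative integer, and a budget $\beta\in\mathbb{N}$, decide whether there is an admissible set $\Gamma$ of swaps of total cost at most $\beta$ such that $p$ is a winner in the $\mathcal{E}$-election $(C,V^{\Gamma})$. Logarithms are to base $2$; arithmetic operations on costs are counted as single steps.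 *)

theory Defs
  imports
    "HOL-Probability.Probability"
    "HOL-Combinatorics.Multiset_Permutations"
begin

section \<open>Elections and Swap Bribery\<close>

text \<open>A strict linear order over \<open>C\<close> is an enumeration of \<open>C\<close> without repetitions, best
  candidate first.  Votes form a list, so that several voters may have the same order.\<close>

type_synonym 'a vote = "'a list"

type_synonym 'a election_system = "'a set \<Rightarrow> 'a vote list \<Rightarrow> 'a set"

definition is_election :: "'a set \<Rightarrow> 'a vote list \<Rightarrow> bool" where
  "is_election C V \<longleftrightarrow> finite C \<and> set V \<subseteq> permutations_of_set C"

definition rank :: "'a \<Rightarrow> 'a vote \<Rightarrow> nat" where
  "rank c v = length (takeWhile (\<lambda>x. x \<noteq> c) v) + 1"

definition approval_score :: "nat \<Rightarrow> 'a vote list \<Rightarrow> 'a \<Rightarrow> nat" where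
  "approval_score k V c = (\<Sum>v\<leftarrow>V. if rank c v \<le> k then 1 else 0)"

definition approval :: "nat \<Rightarrow> 'a election_system" where
  "approval k C V = {c \<in> C. \<forall>d \<in> C. approval_score k V d \<le> approval_score k V c}"

definition admissible_swap :: "'a vote \<Rightarrow> 'a \<Rightarrow> 'a \<Rightarrow> bool" where
  "admissible_swap v a b \<longleftrightarrow>
     a \<in> set v \<and> b \<in> set v \<and> a \<noteq> b \<and> rank a v + 1 = rank b v"

definition apply_swap :: "'a \<Rightarrow> 'a \<Rightarrow> 'a vote \<Rightarrow> 'a vote" where
  "apply_swap a b v = map (Transposition.transpose a b) v"

fun apply_swaps :: "('a \<times> 'a) list \<Rightarrow> 'a vote \<Rightarrow> 'a vote option" where
  "apply_swaps [] v = Some v"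
| "apply_swaps ((a, b) # xs) v =
     (if admissible_swap v a b then apply_swaps xs (apply_swap a b v) else None)"

text \<open>\<open>vote_after S v w\<close>: the set \<open>S\<close> of swaps is admissible in \<open>v\<close> and \<open>w\<close> is the resulting
  vote.  Each element of \<open>S\<close> is applied exactly once.  (The result does not depend on the
  order: two candidates change their relative order iff \<open>S\<close> contains exactly one of their
  two swaps.)\<close>

definition vote_after :: "('a \<times> 'a) set \<Rightarrow> 'a vote \<Rightarrow> 'a vote \<Rightarrow> bool" where
  "vote_after S v w \<longleftrightarrow> (\<exists>xs. distinct xs \<and> set xs = S \<and> apply_swaps xs v = Some w)"

text \<open>In a triple \<open>(i, a, b)\<close> the vote is given by its index \<open>i\<close> in the list of votes.\<close>

definition votes_after ::
    "(nat \<times> 'a \<times> 'a) set \<Rightarrow> 'a vote list \<Rightarrow> 'a vote list \<Rightarrow> bool" where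
  "votes_after \<Gamma> V W \<longleftrightarrow> length W = length V \<and>
     (\<forall>i < length V. vote_after {(a, b). (i, a, b) \<in> \<Gamma>} (V ! i) (W ! i))"

definition swap_bribery ::
    "'a election_system \<Rightarrow> 'a set \<Rightarrow> 'a vote list \<Rightarrow> 'a \<Rightarrow>
     (nat \<Rightarrow> 'a \<Rightarrow> 'a \<Rightarrow> nat) \<Rightarrow> nat \<Rightarrow> bool" where
  "swap_bribery \<E> C V p cost \<beta> \<longleftrightarrow>
     (\<exists>\<Gamma> W. \<Gamma> \<subseteq> {..<length V} \<times> C \<times> C \<and> votes_after \<Gamma> V W \<and>
        (\<Sum>(i, a, b)\<in>\<Gamma>. cost i a b) \<le> \<beta> \<and> p \<in> \<E> C W)"

section \<open>Random access programs\<close>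

text \<open>A structured random access machine.  A store consists of named arrays of natural
  numbers; a program mentions only finitely many names, and a scalar is cell \<open>0\<close> of an array.
  Addition, truncated subtraction, comparison, indirect access and drawing a uniformly random
  bit are single steps on numbers of any size.  Multiplication and division are deliberately
  absent: at unit cost they would make the machine unreasonably powerful.\<close>

type_synonym store = "string \<Rightarrow> nat \<Rightarrow> nat"

datatype aexp = Const nat | Read string aexp | Plus aexp aexp | Minus aexp aexp

datatype bexp = Less aexp aexp | Neg bexp | Conj bexp bexp

datatype com =
    Skip
  | Assign string aexp aexp
  | Flip string aexp
  | Seq com com
  | Cond bexp com com
  | While bexp com

fun aval :: "aexp \<Rightarrow> store \<Rightarrow> nat" where
  "aval (Const c) s = c"
| "aval (Read x e) s = s x (aval e s)"
| "aval (Plus e f) s = aval e s + aval f s"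
| "aval (Minus e f) s = aval e s - aval f s"

fun bval :: "bexp \<Rightarrow> store \<Rightarrow> bool" where
  "bval (Less e f) s = (aval e s < aval f s)"
| "bval (Neg b) s = (\<not> bval b s)"
| "bval (Conj b c) s = (bval b s \<and> bval c s)"

fun acost :: "aexp \<Rightarrow> nat" where
  "acost (Const c) = 1"
| "acost (Read x e) = acost e + 1"
| "acost (Plus e f) = acost e + acost f + 1"
| "acost (Minus e f) = acost e + acost f + 1"

fun bcost :: "bexp \<Rightarrow> nat" where
  "bcost (Less e f) = acost e + acost f + 1"
| "bcost (Neg b) = bcost b + 1"
| "bcost (Conj b c) = bcost b + bcost c + 1"

definition update :: "store \<Rightarrow> string \<Rightarrow> nat \<Rightarrow> nat \<Rightarrow> store" where
  "update s x i a = s(x := (s x)(i := a))"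

text \<open>\<open>exec c s \<omega> t s' \<omega>'\<close>: started in store \<open>s\<close> with the stream \<open>\<omega>\<close> of random bits ahead,
  \<open>c\<close> halts after \<open>t\<close> steps in store \<open>s'\<close>, leaving the bits \<open>\<omega>'\<close> unread.\<close>

inductive exec ::
    "com \<Rightarrow> store \<Rightarrow> bool stream \<Rightarrow> nat \<Rightarrow> store \<Rightarrow> bool stream \<Rightarrow> bool" where
  Skip: "exec Skip s \<omega> 1 s \<omega>"
| Assign: "exec (Assign x e f) s \<omega> (acost e + acost f + 1)
             (update s x (aval e s) (aval f s)) \<omega>"
| Flip: "exec (Flip x e) s \<omega> (acost e + 1)
           (update s x (aval e s) (of_bool (shd \<omega>))) (stl \<omega>)"
| Seq: "\<lbrakk>exec c s \<omega> t s' \<omega>'; exec d s' \<omega>' u s'' \<omega>''\<rbrakk>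
          \<Longrightarrow> exec (Seq c d) s \<omega> (t + u) s'' \<omega>''"
| CondTrue: "\<lbrakk>bval b s; exec c s \<omega> t s' \<omega>'\<rbrakk>
             \<Longrightarrow> exec (Cond b c d) s \<omega> (bcost b + t + 1) s' \<omega>'"
| CondFalse: "\<lbrakk>\<not> bval b s; exec d s \<omega> t s' \<omega>'\<rbrakk>
              \<Longrightarrow> exec (Cond b c d) s \<omega> (bcost b + t + 1) s' \<omega>'"
| WhileFalse: "\<not> bval b s \<Longrightarrow> exec (While b c) s \<omega> (bcost b + 1) s \<omega>"
| WhileTrue: "\<lbrakk>bval b s; exec c s \<omega> t s' \<omega>'; exec (While b c) s' \<omega>' u s'' \<omega>''\<rbrakk>
                \<Longrightarrow> exec (While b c) s \<omega> (bcost b + t + u + 1) s'' \<omega>''"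

lemma exec_deterministic:
  assumes "exec c s \<omega> t s1 \<omega>1" and "exec c s \<omega> u s2 \<omega>2"
  shows "u = t \<and> s2 = s1 \<and> \<omega>2 = \<omega>1"
  using assms
proof (induction arbitrary: u s2 \<omega>2 rule: exec.induct)
  case Skip
  then show ?case by cases auto
next
  case Assign
  then show ?case by cases auto
next
  case Flip
  then show ?case by cases auto
next
  case Seq
  from Seq.prems show ?case by cases (metis Seq.IH)
next
  case CondTrue
  from CondTrue.prems show ?case by cases (use CondTrue.IH CondTrue.hyps in \<open>metis+\<close>)
next
  case CondFalse
  from CondFalse.prems show ?case by cases (use CondFalse.IH CondFalse.hyps in \<open>metis+\<close>)
next
  case WhileFalse
  from WhileFalse.prems show ?case by cases (use WhileFalse.hyps in simp_all)
next
  case WhileTrue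
  from WhileTrue.prems show ?case by cases (use WhileTrue.IH WhileTrue.hyps in \<open>metis+\<close>)
qed

definition run_time :: "com \<Rightarrow> store \<Rightarrow> bool stream \<Rightarrow> ennreal" where
  "run_time c s \<omega> =
     (if \<exists>t s' \<omega>'. exec c s \<omega> t s' \<omega>'
      then of_nat (THE t. \<exists>s' \<omega>'. exec c s \<omega> t s' \<omega>') else \<infinity>)"

definition coins :: "bool stream measure" where
  "coins = stream_space (measure_pmf (bernoulli_pmf (1/2)))"

text \<open>The event that a run halts after \<open>t\<close> steps depends only on the first \<open>t\<close> bits, so the
  running time is measurable.\<close>

definition expected_run_time :: "com \<Rightarrow> store \<Rightarrow> ennreal" where
  "expected_run_time c s = (\<integral>\<^sup>+ \<omega>. run_time c s \<omega> \<partial>coins)"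

fun flip_free :: "com \<Rightarrow> bool" where
  "flip_free (Flip x e) = False"
| "flip_free (Seq c d) = (flip_free c \<and> flip_free d)"
| "flip_free (Cond b c d) = (flip_free c \<and> flip_free d)"
| "flip_free (While b c) = flip_free c"
| "flip_free _ = True"

definition halts :: "com \<Rightarrow> store \<Rightarrow> bool stream \<Rightarrow> bool" where
  "halts c s \<omega> \<longleftrightarrow> (\<exists>t s' \<omega>'. exec c s \<omega> t s' \<omega>')"

text \<open>The answer is left in cell \<open>0\<close> of the array \<open>''out''\<close>: \<open>1\<close> for yes, \<open>0\<close> for no.\<close>

definition never_errs :: "com \<Rightarrow> store \<Rightarrow> bool \<Rightarrow> bool" where
  "never_errs c s ans \<longleftrightarrow>
     (\<forall>\<omega> t s' \<omega>'. exec c s \<omega> t s' \<omega>' \<longrightarrow> s' ''out'' 0 = of_bool ans)"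

section \<open>Swap Bribery for approval voting as input to a program\<close>

text \<open>The candidates are \<open>0, \<dots>, num_cands - 1\<close>.\<close>

record bribery_instance =
  num_cands :: nat
  votes :: "nat vote list"
  preferred :: nat
  swap_cost :: "nat \<Rightarrow> nat \<Rightarrow> nat \<Rightarrow> nat"
  budget :: nat

definition num_votes :: "bribery_instance \<Rightarrow> nat" where
  "num_votes I = length (votes I)"

definition valid_instance :: "bribery_instance \<Rightarrow> bool" where
  "valid_instance I \<longleftrightarrow> is_election {..<num_cands I} (votes I) \<and> votes I \<noteq> [] \<and>
     preferred I < num_cands I"

definition approval_swap_bribery :: "nat \<Rightarrow> bribery_instance \<Rightarrow> bool" where
  "approval_swap_bribery k I \<longleftrightarrow>
     swap_bribery (approval k) {..<num_cands I} (votes I) (preferred I) (swap_cost I) (budget I)"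

text \<open>The votes are stored as an \<open>n \<times> m\<close> matrix and the costs as an \<open>n \<times> m \<times> m\<close> array, both
  row by row; the costs with \<open>a = b\<close> are irrelevant padding.  All other cells are \<open>0\<close>.\<close>

definition scalar :: "nat \<Rightarrow> nat \<Rightarrow> nat" where
  "scalar a j = (if j = 0 then a else 0)"

definition input_store :: "nat \<Rightarrow> bribery_instance \<Rightarrow> store" where
  "input_store k I =
     (let n = num_votes I; m = num_cands I in
      (\<lambda>x j. 0)
        (''n'' := scalar n,
         ''m'' := scalar m,
         ''k'' := scalar k,
         ''p'' := scalar (preferred I),
         ''beta'' := scalar (budget I),
         ''vote'' := (\<lambda>j. if j < n * m then votes I ! (j div m) ! (j mod m) else 0),
         ''cost'' := (\<lambda>j. if j < n * m * m
            then swap_cost I (j div (m * m)) (j div m mod m) (j mod m) else 0)))"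

end

(* One deterministic program serves both halves.  Giving a vote i the top set S costs at least,
   and by adjacent swaps exactly, the total cost of the pairs that S inverts.  So one has to choose
   k-sets S_1, ..., S_n cheaply such that no candidate lies in more of them than p.

   Replacing S_i by a set that contains p if S_i does, and whose new elements (other than p) avoid
   the other sets, keeps p a winner: a new candidate then scores 1, and p scores at least 1.  Let
   Y be the set of at most (n - 1)k elements to avoid.  Grow a kernel A of S_i element by
   element.  Given A, take greedily (n - 1)k + 1 "petals": each is a cheapest k-set that contains
   A and is disjoint outside A from the earlier ones.  Either S_i meets a petal outside A, or
   every petal is at most as expensive as S_i and one of them avoids Y.  In both cases the next
   kernel element can be picked among the elements of the petals, apart from p as a possible
   first element.

   With N = nk this leaves B = ((n - 1)k + 1)k + 1 choices for each of the N positions.  The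
   program tries all B^N strings of choices, each in time O(N^3 m^(k+1)), and 4B <= 3N^2 for
   N >= 2 absorbs the polynomial factor: N^3 B^N = O(N^(2N)). *)

theory Submission
  imports Defs
begin

section \<open>Timed weakest preconditions\<close>

text \<open>Neither the set \<open>S_i\<close> of a solution nor the set to avoid is known to the
  program. The guessing is cheap because the petals are a function of the vote and the kernel alone;
  the unknown sets enter only through the index of the chosen entry, and the range of this index
  does not depend on \<open>m\<close>. The program cannot tell whether a petal is hit by
  \<open>S_i\<close> or replaces it, and it need not: in either case some \<open>k\<close>-set that
  contains the enlarged kernel is no more expensive than \<open>S_i\<close> and still avoids
  \<open>Y\<close>, and the argument goes on with that set. \<open>Y\<close> consists of the members
  of the other sets, without \<open>p\<close> and without the members of \<open>S_i\<close>: more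
  points for \<open>p\<close> do no harm, and a candidate that stays in the set gains nothing. As
  the growth may drop \<open>p\<close>, a set with \<open>p\<close> is regrown from \<open>p\<close>
  alone; this is what the extra choice is for. The constant in front must be the same for all
  \<open>k\<close>, so no factor polynomial in \<open>N\<close> may remain beside
  \<open>N ^ (2 * N)\<close>. Hence the care for the leading coefficient in the bound on
  \<open>B\<close>.\<close>

text \<open>The run must not depend on the random bits and must not consume any of them.\<close>

definition wp :: "com \<Rightarrow> (nat \<Rightarrow> store \<Rightarrow> bool) \<Rightarrow> store \<Rightarrow> bool" where
  "wp c Q s \<longleftrightarrow> (\<exists>t s'. (\<forall>\<omega>. exec c s \<omega> t s' \<omega>) \<and> Q t s')"

fun mods :: "com \<Rightarrow> string set" where
  "mods Skip = {}"
| "mods (Assign x e f) = {x}"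
| "mods (Flip x e) = {x}"
| "mods (Seq c d) = mods c \<union> mods d"
| "mods (Cond b c d) = mods c \<union> mods d"
| "mods (While b c) = mods c"

lemma update_apply: "update s x i a y = (if y = x then (s x)(i := a) else s y)"
  by (simp add: update_def)

lemma exec_frame: "exec c s \<omega> t s' \<omega>' \<Longrightarrow> x \<notin> mods c \<Longrightarrow> s' x = s x"
  by (induction rule: exec.induct) (auto simp: update_apply)

text \<open>Specifications mention only what a sub-program establishes; this rule hands all arrays
  outside \<open>mods c\<close> back to the caller unchanged.\<close>

lemma wp_frame:
  assumes "wp c R s"
    and "\<And>t s'. R t s' \<Longrightarrow> \<forall>x. x \<notin> mods c \<longrightarrow> s' x = s x \<Longrightarrow> Q t s'"
  shows "wp c Q s"
  using assms unfolding wp_def by (metis exec_frame)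

lemma wp_mono: "wp c R s \<Longrightarrow> (\<And>t s'. R t s' \<Longrightarrow> Q t s') \<Longrightarrow> wp c Q s"
  unfolding wp_def by blast

lemma wp_Skip: "Q 1 s \<Longrightarrow> wp Skip Q s"
  unfolding wp_def using exec.Skip by blast

lemma wp_Assign:
  "Q (acost e + acost f + 1) (update s x (aval e s) (aval f s)) \<Longrightarrow> wp (Assign x e f) Q s"
  unfolding wp_def using exec.Assign by blast

lemma wp_Seq: "wp c (\<lambda>t s'. wp d (\<lambda>u. Q (t + u)) s') s \<Longrightarrow> wp (Seq c d) Q s"
  unfolding wp_def by (meson exec.Seq)

lemma wp_Cond:
  assumes "bval b s \<Longrightarrow> wp c (\<lambda>t. Q (bcost b + t + 1)) s"
    and "\<not> bval b s \<Longrightarrow> wp d (\<lambda>t. Q (bcost b + t + 1)) s"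
  shows "wp (Cond b c d) Q s"
  using assms unfolding wp_def by (cases "bval b s") (meson exec.CondTrue exec.CondFalse)+

text \<open>The invariant is indexed by the number of completed rounds and the total
  \<open>N\<close> is fixed in advance, so one induction on the rounds still to run gives
  termination and the time bound together.\<close>

lemma wp_While:
  assumes init: "I 0 s"
    and cond: "\<And>i s. I i s \<Longrightarrow> i \<le> N \<Longrightarrow> bval b s \<longleftrightarrow> i < N"
    and body: "\<And>i s. i < N \<Longrightarrow> I i s \<Longrightarrow> wp c (\<lambda>t s'. t \<le> T \<and> I (Suc i) s') s"
    and post: "\<And>t s'. I N s' \<Longrightarrow> t \<le> N * (T + bcost b + 1) + bcost b + 1 \<Longrightarrow> Q t s'"
  shows "wp (While b c) Q s"
proof -
  have "wp (While b c) (\<lambda>t s'. t \<le> d * (T + bcost b + 1) + bcost b + 1 \<and> I N s') s"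
    if "I i s" "N = i + d" for d i s
    using that
  proof (induction d arbitrary: i s)
    case 0
    then have "\<not> bval b s" using cond[of i s] by simp
    from exec.WhileFalse[OF this] have "\<forall>\<omega>. exec (While b c) s \<omega> (bcost b + 1) s \<omega>" by blast
    with 0 show ?case unfolding wp_def by fastforce
  next
    case (Suc d)
    then have b: "bval b s" and "i < N" using cond[of i s] by auto
    from body[OF \<open>i < N\<close> Suc.prems(1)] obtain t s' where
      1: "\<forall>\<omega>. exec c s \<omega> t s' \<omega>" "t \<le> T" "I (Suc i) s'" unfolding wp_def by blast
    from Suc.IH[OF 1(3)] Suc.prems obtain u s'' where
      2: "\<forall>\<omega>. exec (While b c) s' \<omega> u s'' \<omega>" "I N s''"
         "u \<le> d * (T + bcost b + 1) + bcost b + 1" unfolding wp_def by auto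
    show ?case unfolding wp_def
    proof (intro exI conjI allI)
      show "exec (While b c) s \<omega> (bcost b + t + u + 1) s'' \<omega>" for \<omega>
        using exec.WhileTrue[OF b] 1(1) 2(1) by blast
      show "bcost b + t + u + 1 \<le> Suc d * (T + bcost b + 1) + bcost b + 1"
        using 1(2) 2(3) by simp
    qed (rule 2)
  qed
  from this[of 0 s N] init have
    "wp (While b c) (\<lambda>t s'. t \<le> N * (T + bcost b + 1) + bcost b + 1 \<and> I N s') s" by simp
  then show ?thesis by (rule wp_mono) (auto intro: post)
qed

section \<open>Abbreviations and counted loops\<close>

abbreviation Val :: "string \<Rightarrow> aexp" where "Val x \<equiv> Read x (Const 0)"

abbreviation Put :: "string \<Rightarrow> aexp \<Rightarrow> com" where "Put x e \<equiv> Assign x (Const 0) e"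

abbreviation Eq :: "aexp \<Rightarrow> aexp \<Rightarrow> bexp" where
  "Eq e f \<equiv> Conj (Neg (Less e f)) (Neg (Less f e))"

definition For :: "string \<Rightarrow> aexp \<Rightarrow> com \<Rightarrow> com" where
  "For x e c = Seq (Put x (Const 0))
     (While (Less (Val x) e) (Seq c (Put x (Plus (Val x) (Const 1)))))"

lemma mods_For [simp]: "mods (For x e c) = insert x (mods c)"
  by (auto simp: For_def)

lemma flip_free_For [simp]: "flip_free (For x e c) = flip_free c"
  by (auto simp: For_def)

text \<open>\<open>e\<close> is evaluated anew before each round, hence \<open>lim\<close> asks for
  the same value in every store that the loop can reach. By \<open>stable\<close> the invariant
  ignores cell 0 of the counter, which is set outside \<open>c\<close>. The 10 steps per round are 6
  for the increment and, on top of \<open>acost e\<close>, 4 for the test.\<close>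

lemma wp_For:
  assumes x: "x \<notin> mods c"
    and lim: "\<And>s'. \<forall>y. y \<notin> insert x (mods c) \<longrightarrow> s' y = s y \<Longrightarrow> aval e s' = N"
    and init: "I 0 s"
    and stable: "\<And>i s a. I i s \<Longrightarrow> I i (update s x 0 a)"
    and body: "\<And>i s'. i < N \<Longrightarrow> I i s' \<Longrightarrow> s' x 0 = i \<Longrightarrow>
        \<forall>y. y \<notin> insert x (mods c) \<longrightarrow> s' y = s y \<Longrightarrow> wp c (\<lambda>t s''. t \<le> T \<and> I (Suc i) s'') s'"
    and post: "\<And>t s'. I N s' \<Longrightarrow> s' x 0 = N \<Longrightarrow>
        \<forall>y. y \<notin> insert x (mods c) \<longrightarrow> s' y = s y \<Longrightarrow>
        t \<le> N * (T + acost e + 10) + acost e + 10 \<Longrightarrow> Q t s'"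
  shows "wp (For x e c) Q s"
proof -
  let ?F = "\<lambda>s'. \<forall>y. y \<notin> insert x (mods c) \<longrightarrow> s' y = s y"
  let ?J = "\<lambda>i s'. I i s' \<and> s' x 0 = i \<and> ?F s'"
  show ?thesis unfolding For_def
  proof (intro wp_Seq wp_Assign)
    show "wp (While (Less (Val x) e) (Seq c (Put x (Plus (Val x) (Const 1)))))
      (\<lambda>u. Q (acost (Const 0) + acost (Const 0) + 1 + u))
      (update s x (aval (Const 0) s) (aval (Const 0) s))"
    proof (rule wp_While[where I = ?J and N = N and T = "T + 6"])
      show "?J 0 (update s x (aval (Const 0) s) (aval (Const 0) s))"
        using init stable by (simp add: update_apply)
      show "bval (Less (Val x) e) s' \<longleftrightarrow> i < N" if "?J i s'" for i s'
        using that lim[of s'] by simp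
      show "wp (Seq c (Put x (Plus (Val x) (Const 1)))) (\<lambda>t s''. t \<le> T + 6 \<and> ?J (Suc i) s'') s'"
        if i: "i < N" and J: "?J i s'" for i s'
      proof (intro wp_Seq, rule wp_frame)
        show "wp c (\<lambda>t s''. t \<le> T \<and> I (Suc i) s'') s'" using body i J by blast
        show "wp (Put x (Plus (Val x) (Const 1))) (\<lambda>u s''. t + u \<le> T + 6 \<and> ?J (Suc i) s'') s''"
          if "t \<le> T \<and> I (Suc i) s''" "\<forall>x. x \<notin> mods c \<longrightarrow> s'' x = s' x" for t s''
          using that J x by (intro wp_Assign) (auto simp: update_apply stable)
      qed
      show "Q (acost (Const 0) + acost (Const 0) + 1 + t) s'" if "?J N s'"
        "t \<le> N * (T + 6 + bcost (Less (Val x) e) + 1) + bcost (Less (Val x) e) + 1" for t s'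
        using that by (intro post) (auto simp: algebra_simps)
    qed
  qed
qed

section \<open>Positional notation and the enumeration of all strings\<close>

definition digit :: "nat \<Rightarrow> nat \<Rightarrow> nat \<Rightarrow> nat" where
  "digit b v e = v div b ^ e mod b"

lemma digit_0 [simp]: "digit b v 0 = v mod b" and
  digit_Suc [simp]: "digit b v (Suc e) = digit b (v div b) e" and
  digit_zero [simp]: "digit b 0 e = 0"
  by (simp_all add: digit_def div_mult2_eq)

lemma digit_less: "0 < b \<Longrightarrow> digit b v e < b"
  by (simp add: digit_def)

text \<open>Carrying, with the lowest digit peeled off: if it is \<open>b - 1\<close>, then
  \<open>Suc v div b = Suc (v div b)\<close>, so the remaining digits are again those of a
  successor.\<close>

lemma digit_succ:
  assumes "0 < b" and "\<forall>e < h. digit b v e = b - 1"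
  shows "e < h \<Longrightarrow> digit b (Suc v) e = 0"
    and "Suc (digit b v h) < b \<Longrightarrow> digit b (Suc v) h = Suc (digit b v h)"
    and "Suc (digit b v h) < b \<Longrightarrow> h < e \<Longrightarrow> digit b (Suc v) e = digit b v e"
proof -
  have "(\<forall>e < h. digit b (Suc v) e = 0) \<and> (Suc (digit b v h) < b \<longrightarrow>
     digit b (Suc v) h = Suc (digit b v h) \<and> (\<forall>e > h. digit b (Suc v) e = digit b v e))"
    using assms(2)
  proof (induction h arbitrary: v)
    case 0
    have "Suc v div b = v div b" "Suc v mod b = Suc (v mod b)" if "Suc (v mod b) < b"
      using that by (simp_all add: mod_Suc div_Suc)
    then show ?case by (auto simp: gr0_conv_Suc)
  next
    case (Suc h)
    have "v mod b = b - 1" using Suc.prems by force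
    then have *: "Suc v mod b = 0" "Suc v div b = Suc (v div b)"
      using assms(1) by (simp_all add: mod_Suc div_Suc)
    have "\<forall>e<h. digit b (v div b) e = b - 1" using Suc.prems by force
    from Suc.IH[OF this] * show ?case
      by (auto simp: less_Suc_eq_0_disj Suc_less_eq2)
  qed
  then show "e < h \<Longrightarrow> digit b (Suc v) e = 0"
    "Suc (digit b v h) < b \<Longrightarrow> digit b (Suc v) h = Suc (digit b v h)"
    "Suc (digit b v h) < b \<Longrightarrow> h < e \<Longrightarrow> digit b (Suc v) e = digit b v e" by auto
qed

text \<open>Detects the end of an enumeration: the carry leaves the string exactly at the last
  number.\<close>

lemma digits_max_iff:
  assumes "0 < b"
  shows "v < b ^ l \<Longrightarrow> (\<forall>e < l. digit b v e = b - 1) \<longleftrightarrow> Suc v = b ^ l"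
proof (induction l arbitrary: v)
  case 0
  then show ?case by simp
next
  case (Suc l)
  have "v div b < b ^ l" using Suc.prems by (simp add: less_mult_imp_div_less mult.commute)
  note IH = Suc.IH[OF this]
  have "(\<forall>e < Suc l. digit b v e = b - 1) \<longleftrightarrow> v mod b = b - 1 \<and> Suc (v div b) = b ^ l"
    using IH by (auto simp: less_Suc_eq_0_disj)
  also have "\<dots> \<longleftrightarrow> Suc v = b ^ Suc l"
  proof
    assume "v mod b = b - 1 \<and> Suc (v div b) = b ^ l"
    then have "b ^ Suc l = b * (v div b) + v mod b + 1" using assms
      by (metis Suc_eq_plus1 Suc_pred' add.assoc mult_Suc_right power_Suc add.commute)
    then show "Suc v = b ^ Suc l" by simp
  next
    assume a: "Suc v = b ^ Suc l"
    then have m: "Suc v mod b = 0" by simp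
    then have "v mod b = b - 1" using assms by (simp add: mod_Suc split: if_splits)
    moreover have "Suc v div b = Suc (v div b)" using m by (simp add: div_Suc)
    moreover have "Suc v div b = b ^ l" using a assms by simp
    ultimately show "v mod b = b - 1 \<and> Suc (v div b) = b ^ l" by simp
  qed
  finally show ?case .
qed

lemma digits_surj:
  assumes "\<forall>e < l. f e < b"
  shows "\<exists>v < b ^ l. \<forall>e < l. digit b v e = f e"
  using assms
proof (induction l arbitrary: f)
  case (Suc l)
  from Suc.IH[of "\<lambda>e. f (Suc e)"] Suc.prems obtain v where
    v: "v < b ^ l" "\<forall>e < l. digit b v e = f (Suc e)" by auto
  have "f 0 < b" using Suc.prems by simp
  have "f 0 + b * v < b * Suc v" using \<open>f 0 < b\<close> by simp
  also have "\<dots> \<le> b * b ^ l" using v(1) by (intro mult_le_mono2) simp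
  finally show ?case using v \<open>f 0 < b\<close>
    by (intro exI[of _ "f 0 + b * v"]) (auto simp: less_Suc_eq_0_disj)
qed simp

text \<open>An odometer step. \<open>h\<close> passes over the maximal digits and resets them; if it
  runs off the end, all strings have been seen.\<close>

definition Next :: "string \<Rightarrow> string \<Rightarrow> string \<Rightarrow> aexp \<Rightarrow> aexp \<Rightarrow> com" where
  "Next arr h go l b =
     Seq (Put h (Const 0))
    (Seq (While (Conj (Less (Val h) l) (Neg (Less (Plus (Read arr (Val h)) (Const 1)) b)))
           (Seq (Assign arr (Val h) (Const 0)) (Put h (Plus (Val h) (Const 1)))))
         (Cond (Less (Val h) l) (Assign arr (Val h) (Plus (Read arr (Val h)) (Const 1)))
           (Put go (Const 0))))"

lemma mods_Next [simp]: "mods (Next arr h go l b) = {arr, h, go}"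
  by (auto simp: Next_def)

lemma flip_free_Next [simp]: "flip_free (Next arr h go l b)"
  by (auto simp: Next_def)

lemma wp_Next:
  assumes d: "arr \<noteq> h" "arr \<noteq> go" "h \<noteq> go"
    and l: "\<And>s'. \<forall>y. y \<notin> {arr, h, go} \<longrightarrow> s' y = s y \<Longrightarrow> aval l s' = ll"
    and b: "\<And>s'. \<forall>y. y \<notin> {arr, h, go} \<longrightarrow> s' y = s y \<Longrightarrow> aval b s' = bb"
    and bb: "0 < bb" and v: "v < bb ^ ll"
    and arr: "\<forall>e < ll. s arr e = digit bb v e"
    and go: "s go 0 = 1"
  shows "wp (Next arr h go l b) (\<lambda>t s'. t \<le> ll * (acost l + acost b + 25) + 2 * (acost l + acost b) + 40
      \<and> s' go 0 = of_bool (Suc v < bb ^ ll)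
      \<and> (Suc v < bb ^ ll \<longrightarrow> (\<forall>e < ll. s' arr e = digit bb (Suc v) e))) s"
proof -
  \<comment> \<open>The place where the carry stops; \<open>H = ll\<close> stands for an
    overflow.\<close>
  define H where "H = (LEAST h. h = ll \<or> Suc (digit bb v h) < bb)"
  have H: "H = ll \<or> Suc (digit bb v H) < bb"
    unfolding H_def by (rule LeastI[of _ ll]) simp
  have Hle: "H \<le> ll" unfolding H_def by (rule Least_le) simp
  have below: "digit bb v e = bb - 1" if "e < H" for e
    using not_less_Least[OF that[unfolded H_def]] digit_less[OF bb, of v e] by auto
  let ?F = "\<lambda>s'. \<forall>y. y \<notin> {arr, h, go} \<longrightarrow> s' y = s y"
  let ?I = "\<lambda>i s'. s' h 0 = i \<and> s' go 0 = 1 \<and> ?F s' \<and>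
     (\<forall>e < ll. s' arr e = (if e < i then 0 else digit bb v e))"
  let ?b = "Conj (Less (Val h) l) (Neg (Less (Plus (Read arr (Val h)) (Const 1)) b))"
  have fin: "H < ll \<longleftrightarrow> Suc v < bb ^ ll"
  proof -
    have "H = ll \<longleftrightarrow> (\<forall>e < ll. digit bb v e = bb - 1)"
    proof
      assume "\<forall>e < ll. digit bb v e = bb - 1"
      then have "\<not> H < ll" using H bb by fastforce
      then show "H = ll" using Hle by simp
    qed (use below in simp)
    then have "H = ll \<longleftrightarrow> Suc v = bb ^ ll" using digits_max_iff[OF bb v] by simp
    then show ?thesis using Hle v by linarith
  qed
  show ?thesis unfolding Next_def
  proof (intro wp_Seq wp_Assign, rule wp_While[where I = ?I and N = H and T = 11])
    show "?I 0 (update s h (aval (Const 0) s) (aval (Const 0) s))"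
      using d arr go by (simp add: update_apply)
    show "bval ?b s' \<longleftrightarrow> i < H" if "?I i s'" "i \<le> H" for i s'
      using that l[of s'] b[of s'] H Hle below[of i] bb by (auto simp: le_less)
    show "wp (Seq (Assign arr (Val h) (Const 0)) (Put h (Plus (Val h) (Const 1))))
        (\<lambda>t s'. t \<le> 11 \<and> ?I (Suc i) s') s'" if "i < H" "?I i s'" for i s'
      using that d by (intro wp_Seq wp_Assign) (auto simp: update_apply)
    show "wp (Cond (Less (Val h) l) (Assign arr (Val h) (Plus (Read arr (Val h)) (Const 1))) (Put go (Const 0)))
       (\<lambda>u s'. acost (Const 0) + acost (Const 0) + 1 + (t + u) \<le> ll * (acost l + acost b + 25) + 2 * (acost l + acost b) + 40
      \<and> s' go 0 = of_bool (Suc v < bb ^ ll)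
      \<and> (Suc v < bb ^ ll \<longrightarrow> (\<forall>e < ll. s' arr e = digit bb (Suc v) e))) s'"
      if I: "?I H s'" and t: "t \<le> H * (11 + bcost ?b + 1) + bcost ?b + 1" for t s'
    proof -
      have "H * (11 + bcost ?b + 1) \<le> ll * (acost l + acost b + 25)"
        using Hle by (intro mult_le_mono) simp_all
      then have t': "t \<le> ll * (acost l + acost b + 25) + acost l + acost b + 12"
        using t by simp
      show ?thesis
      proof (intro wp_Cond wp_Assign)
        assume "bval (Less (Val h) l) s'"
        then have "H < ll" using I l[of s'] by simp
        then have "Suc v < bb ^ ll" "Suc (digit bb v H) < bb" using fin H by auto
        then show "acost (Const 0) + acost (Const 0) + 1 + (t + (bcost (Less (Val h) l) +
            (acost (Val h) + acost (Plus (Read arr (Val h)) (Const 1)) + 1) + 1))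
            \<le> ll * (acost l + acost b + 25) + 2 * (acost l + acost b) + 40 \<and>
           update s' arr (aval (Val h) s') (aval (Plus (Read arr (Val h)) (Const 1)) s') go 0
             = of_bool (Suc v < bb ^ ll) \<and>
           (Suc v < bb ^ ll \<longrightarrow> (\<forall>e < ll. update s' arr (aval (Val h) s')
             (aval (Plus (Read arr (Val h)) (Const 1)) s') arr e = digit bb (Suc v) e))"
          using t' I d \<open>H < ll\<close> digit_succ[OF bb, of H v] below
          by (auto simp: update_apply)
      next
        assume "\<not> bval (Less (Val h) l) s'"
        then have "\<not> H < ll" using I l[of s'] by simp
        then show "acost (Const 0) + acost (Const 0) + 1 + (t + (bcost (Less (Val h) l) +
            (acost (Const 0) + acost (Const 0) + 1) + 1))
            \<le> ll * (acost l + acost b + 25) + 2 * (acost l + acost b) + 40 \<and>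
           update s' go (aval (Const 0) s') (aval (Const 0) s') go 0
             = of_bool (Suc v < bb ^ ll) \<and>
           (Suc v < bb ^ ll \<longrightarrow> (\<forall>e < ll. update s' go (aval (Const 0) s')
             (aval (Const 0) s') arr e = digit bb (Suc v) e))"
          using t' fin by (auto simp: update_apply)
      qed
    qed
  qed
qed

text \<open>The program holds only the digits of the current string; its number \<open>v\<close>
  exists in the invariants alone. The end is signalled by a flag, so the number of strings never has
  to be computed.\<close>

definition Enum :: "string \<Rightarrow> string \<Rightarrow> string \<Rightarrow> aexp \<Rightarrow> aexp \<Rightarrow> com \<Rightarrow> com" where
  "Enum arr h go l b c =
     Seq (For h l (Assign arr (Val h) (Const 0)))
    (Seq (Put go (Const 1)) (While (Less (Const 0) (Val go)) (Seq c (Next arr h go l b))))"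

lemma mods_Enum [simp]: "mods (Enum arr h go l b c) = {arr, h, go} \<union> mods c"
  by (auto simp: Enum_def)

lemma flip_free_Enum [simp]: "flip_free (Enum arr h go l b c) = flip_free c"
  by (auto simp: Enum_def)

lemma wp_Enum:
  assumes d: "arr \<noteq> h" "arr \<noteq> go" "h \<noteq> go"
    and m: "arr \<notin> mods c" "h \<notin> mods c" "go \<notin> mods c"
    and l: "\<And>s'. \<forall>y. y \<notin> {arr, h, go} \<union> mods c \<longrightarrow> s' y = s y \<Longrightarrow> aval l s' = ll"
    and b: "\<And>s'. \<forall>y. y \<notin> {arr, h, go} \<union> mods c \<longrightarrow> s' y = s y \<Longrightarrow> aval b s' = bb"
    and bb: "0 < bb"
    and init: "I 0 s"
    and stable: "\<And>v s s'. I v s \<Longrightarrow> \<forall>y. y \<notin> {arr, h, go} \<longrightarrow> s' y = s y \<Longrightarrow> I v s'"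
    and body: "\<And>v s'. v < bb ^ ll \<Longrightarrow> I v s' \<Longrightarrow> \<forall>e < ll. s' arr e = digit bb v e \<Longrightarrow>
        \<forall>y. y \<notin> {arr, h, go} \<union> mods c \<longrightarrow> s' y = s y \<Longrightarrow>
        wp c (\<lambda>t s''. t \<le> T \<and> I (Suc v) s'') s'"
    and post: "\<And>t s'. I (bb ^ ll) s' \<Longrightarrow> \<forall>y. y \<notin> {arr, h, go} \<union> mods c \<longrightarrow> s' y = s y \<Longrightarrow>
        t \<le> bb ^ ll * (T + (2 * ll + 4) * (acost l + acost b + 30)) \<Longrightarrow> Q t s'"
  shows "wp (Enum arr h go l b c) Q s"
proof -
  let ?F = "\<lambda>s'. \<forall>y. y \<notin> {arr, h, go} \<union> mods c \<longrightarrow> s' y = s y"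
  let ?J = "\<lambda>v s'. I v s' \<and> ?F s' \<and> s' go 0 = of_bool (v < bb ^ ll) \<and>
     (v < bb ^ ll \<longrightarrow> (\<forall>e < ll. s' arr e = digit bb v e))"
  let ?N = "ll * (acost l + acost b + 25) + 2 * (acost l + acost b) + 40"
  have pos: "0 < bb ^ ll" using bb by simp
  show ?thesis unfolding Enum_def
  proof (rule wp_Seq, rule wp_For[where N = ll and T = 4 and
        I = "\<lambda>i s'. \<forall>e < i. s' arr e = 0"])
    fix t s1
    assume 1: "\<forall>e < ll. s1 arr e = 0"
      "\<forall>y. y \<notin> insert h (mods (Assign arr (Val h) (Const 0))) \<longrightarrow> s1 y = s y"
      and t: "t \<le> ll * (4 + acost l + 10) + acost l + 10"
    have I1: "I 0 s1" by (rule stable[OF init]) (use 1 in auto)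
    show "wp (Seq (Put go (Const 1)) (While (Less (Const 0) (Val go)) (Seq c (Next arr h go l b))))
        (\<lambda>u. Q (t + u)) s1"
    proof (intro wp_Seq wp_Assign, rule wp_While[where I = ?J and N = "bb ^ ll" and T = "T + ?N"])
      show "?J 0 (update s1 go (aval (Const 0) s1) (aval (Const 1) s1))"
        using 1 d pos stable[OF I1, of "update s1 go 0 1"] by (auto simp: update_apply)
      show "bval (Less (Const 0) (Val go)) s' \<longleftrightarrow> v < bb ^ ll" if "?J v s'" for v s'
        using that by simp
      show "wp (Seq c (Next arr h go l b)) (\<lambda>t s''. t \<le> T + ?N \<and> ?J (Suc v) s'') s'"
        if v: "v < bb ^ ll" and J: "?J v s'" for v s'
      proof (rule wp_Seq, rule wp_frame)
        show "wp c (\<lambda>t s''. t \<le> T \<and> I (Suc v) s'') s'" using body v J by blast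
        fix t s2
        assume 2: "t \<le> T \<and> I (Suc v) s2" "\<forall>x. x \<notin> mods c \<longrightarrow> s2 x = s' x"
        show "wp (Next arr h go l b) (\<lambda>u s''. t + u \<le> T + ?N \<and> ?J (Suc v) s'') s2"
        proof (rule wp_frame[OF wp_Next[OF d, where ll = ll and bb = bb and v = v]])
          show "aval l s'' = ll" "aval b s'' = bb" if "\<forall>y. y \<notin> {arr, h, go} \<longrightarrow> s'' y = s2 y" for s''
            using that 2 J by (auto intro!: l b)
          show "\<forall>e < ll. s2 arr e = digit bb v e" "s2 go 0 = 1" using J 2 v m by auto
          fix u s3
          assume 3: "u \<le> ?N \<and> s3 go 0 = of_bool (Suc v < bb ^ ll)
            \<and> (Suc v < bb ^ ll \<longrightarrow> (\<forall>e < ll. s3 arr e = digit bb (Suc v) e))"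
            "\<forall>x. x \<notin> mods (Next arr h go l b) \<longrightarrow> s3 x = s2 x"
          then have "I (Suc v) s3" using 2 stable[of "Suc v" s2 s3] by auto
          moreover have "?F s3" using 2 3 J by auto
          ultimately show "t + u \<le> T + ?N \<and> ?J (Suc v) s3" using 2 3 by auto
        qed (use bb v in auto)
      qed
      show "Q (t + (acost (Const 0) + acost (Const 1) + 1 + u)) s2"
        if J: "?J (bb ^ ll) s2" and u: "u \<le> bb ^ ll * (T + ?N + bcost (Less (Const 0) (Val go)) + 1)
          + bcost (Less (Const 0) (Val go)) + 1" for u s2
      proof (rule post)
        have "t + (acost (Const 0) + acost (Const 1) + 1 + u) \<le>
           bb ^ ll * (T + ?N + 5) + (ll * (4 + acost l + 10) + acost l + 20)"
          using t u by simp
        \<comment> \<open>The set-up is charged to the rounds, of which there is at least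
          one.\<close>
        also have "\<dots> \<le> bb ^ ll * (T + ?N + 5) + bb ^ ll * (ll * (4 + acost l + 10) + acost l + 20)"
          using Suc_leI[OF pos] by simp
        also have "\<dots> \<le> bb ^ ll * (T + (2 * ll + 4) * (acost l + acost b + 30))"
          unfolding distrib_left[symmetric] by (intro mult_le_mono2) (simp add: algebra_simps)
        finally show "t + (acost (Const 0) + acost (Const 1) + 1 + u)
          \<le> bb ^ ll * (T + (2 * ll + 4) * (acost l + acost b + 30))" .
      qed (use J in auto)
    qed
  next
    show "aval l s' = ll" if "\<forall>y. y \<notin> insert h (mods (Assign arr (Val h) (Const 0))) \<longrightarrow> s' y = s y" for s'
      using that by (intro l) auto
  qed (use d in \<open>auto simp: update_apply less_Suc_eq intro!: wp_Assign\<close>)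
qed

section \<open>The cost of making a set the top of a vote\<close>

lemma rank_nth: "distinct v \<Longrightarrow> r < length v \<Longrightarrow> rank (v ! r) v = Suc r"
proof -
  assume v: "distinct v" "r < length v"
  then have "takeWhile (\<lambda>x. x \<noteq> v ! r) v = take r v"
    by (intro takeWhile_eq_take_P_nth) (auto simp: nth_eq_iff_index_eq)
  then show ?thesis using v by (simp add: rank_def)
qed

lemma length_takeWhile_neq: "a \<in> set v \<Longrightarrow> length (takeWhile (\<lambda>x. x \<noteq> a) v) < length v"
  by (induction v) auto

lemma rank_le_length: "a \<in> set v \<Longrightarrow> rank a v \<le> length v"
  using length_takeWhile_neq[of a v] by (simp add: rank_def)

lemma rank_pos: "0 < rank a v"
  by (simp add: rank_def)

lemma nth_rank: "a \<in> set v \<Longrightarrow> v ! (rank a v - 1) = a"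
proof -
  assume "a \<in> set v"
  then have "length (takeWhile (\<lambda>x. x \<noteq> a) v) < length v"
    by (rule length_takeWhile_neq)
  from nth_length_takeWhile[OF this] show ?thesis by (simp add: rank_def)
qed

lemma rank_eq_iff: "a \<in> set v \<Longrightarrow> b \<in> set v \<Longrightarrow> rank a v = rank b v \<longleftrightarrow> a = b"
  by (metis nth_rank)

lemma rank_le_iff: "distinct v \<Longrightarrow> a \<in> set v \<Longrightarrow> rank a v \<le> k \<longleftrightarrow> a \<in> set (take k v)"
proof
  assume v: "distinct v" "a \<in> set v"
  {
    assume "rank a v \<le> k"
    then have "rank a v - 1 < length (take k v)"
      using rank_le_length[OF v(2)] rank_pos[of a v] by (simp add: less_eq_Suc_le)
    from nth_mem[OF this] show "a \<in> set (take k v)"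
      using \<open>rank a v \<le> k\<close> rank_pos[of a v] nth_rank[OF v(2)] by simp
  next
    assume "a \<in> set (take k v)"
    then obtain r where "r < k" "r < length v" "a = v ! r" by (auto simp: in_set_conv_nth)
    then show "rank a v \<le> k" using rank_nth v by force
  }
qed

lemma rank_apply_swap: "rank x (apply_swap a b v) = rank (Transposition.transpose a b x) v"
proof -
  have "(\<lambda>y. Transposition.transpose a b y \<noteq> x) = (\<lambda>y. y \<noteq> Transposition.transpose a b x)"
    by (metis transpose_involutory)
  then show ?thesis by (simp add: rank_def apply_swap_def takeWhile_map o_def)
qed

lemma apply_swap_vote:
  assumes "a \<in> set v" "b \<in> set v"
  shows "set (apply_swap a b v) = set v" and "distinct (apply_swap a b v) = distinct v"
    and "length (apply_swap a b v) = length v"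
  using assms by (auto simp: apply_swap_def distinct_map inj_on_transpose)

text \<open>A swap reverses the order of the swapped pair and of no other pair.\<close>

lemma apply_swaps_reversed:
  assumes "apply_swaps xs v = Some w" "distinct v"
  shows "distinct w \<and> set w = set v \<and>
    (\<forall>a \<in> set v. \<forall>b \<in> set v. rank a v < rank b v \<longrightarrow> rank b w < rank a w \<longrightarrow> (a, b) \<in> set xs)"
  using assms
proof (induction xs v rule: apply_swaps.induct)
  case (1 v)
  then show ?case by auto
next
  case (2 a b xs v)
  then have ad: "admissible_swap v a b" and r: "apply_swaps xs (apply_swap a b v) = Some w"
    by (auto split: if_splits)
  then have ab: "a \<in> set v" "b \<in> set v" "a \<noteq> b" "rank a v + 1 = rank b v"
    by (auto simp: admissible_swap_def)
  note IH = "2.IH"[OF ad r]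
  have sw: "distinct (apply_swap a b v)" "set (apply_swap a b v) = set v"
    using apply_swap_vote[OF ab(1,2)] "2.prems" by auto
  have "(c, d) \<in> set ((a, b) # xs)"
    if cd: "c \<in> set v" "d \<in> set v" "rank c v < rank d v" "rank d w < rank c w" for c d
  proof (cases "(c, d) = (a, b)")
    case False
    have r: "rank c v = rank a v \<longleftrightarrow> c = a" "rank c v = rank b v \<longleftrightarrow> c = b"
      "rank d v = rank a v \<longleftrightarrow> d = a" "rank d v = rank b v \<longleftrightarrow> d = b"
      using cd ab by (simp_all add: rank_eq_iff)
    have "rank c (apply_swap a b v) < rank d (apply_swap a b v)"
      using cd ab False r
      by (cases "c = a"; cases "c = b"; cases "d = a"; cases "d = b")
         (auto simp: rank_apply_swap)
    then show ?thesis using IH sw cd by auto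
  qed simp
  then show ?case using IH sw by auto
qed

section \<open>Inversions and the cheapest way to bring a set to the top\<close>

definition inversions :: "'a vote \<Rightarrow> 'a set \<Rightarrow> ('a \<times> 'a) set" where
  "inversions v S = {(a, b). a \<in> set v - S \<and> b \<in> S \<and> rank a v < rank b v}"

lemma finite_inversions: "S \<subseteq> set v \<Longrightarrow> finite (inversions v S)"
  by (rule finite_subset[of _ "set v \<times> set v"]) (auto simp: inversions_def)

text \<open>An inverted pair of minimal distance is adjacent, and swapping it removes exactly this
  inversion.\<close>

lemma swaps_to_top:
  assumes "distinct v" "S \<subseteq> set v"
  shows "\<exists>xs w. distinct xs \<and> set xs = inversions v S \<and> apply_swaps xs v = Some w \<and>
    distinct w \<and> set w = set v \<and> inversions w S = {}"
  using assms
proof (induction "card (inversions v S)" arbitrary: v rule: less_induct)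
  case less
  show ?case
  proof (cases "inversions v S = {}")
    case True
    then show ?thesis using less.prems by (intro exI[of _ "[]"] exI[of _ v]) auto
  next
    case False
    then obtain x0 where "x0 \<in> inversions v S" by blast
    from ex_has_least_nat[of "\<lambda>x. x \<in> inversions v S", OF this, of "\<lambda>(c, d). rank d v - rank c v"]
    obtain x where x: "x \<in> inversions v S" "\<forall>y. y \<in> inversions v S \<longrightarrow>
      (case x of (c, d) \<Rightarrow> rank d v - rank c v) \<le> (case y of (c, d) \<Rightarrow> rank d v - rank c v)" by blast
    obtain a b where "x = (a, b)" by fastforce
    with x have ab: "(a, b) \<in> inversions v S"
      and min: "\<And>c d. (c, d) \<in> inversions v S \<Longrightarrow> rank b v - rank a v \<le> rank d v - rank c v"
      by auto
    from ab have ab': "a \<in> set v" "a \<notin> S" "b \<in> S" "b \<in> set v" "rank a v < rank b v" "a \<noteq> b"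
      using less.prems by (auto simp: inversions_def)
    have adj: "rank a v + 1 = rank b v"
    proof (rule ccontr)
      assume "rank a v + 1 \<noteq> rank b v"
      then have l: "rank a v + 1 < rank b v" using ab' by simp
      \<comment> \<open>Ranks start at 1 and list indices at 0, so this is the candidate right
        behind \<open>a\<close>. Depending on whether it is in \<open>S\<close>, it forms a shorter
        inversion with \<open>a\<close> or with \<open>b\<close>.\<close>
      define x where "x = v ! rank a v"
      have "rank a v < length v" using l rank_le_length[OF ab'(4)] by simp
      then have x: "x \<in> set v" "rank x v = rank a v + 1"
        using rank_nth[OF less.prems(1)] by (auto simp: x_def)
      then have "(a, x) \<in> inversions v S \<or> (x, b) \<in> inversions v S"
        using ab' l by (auto simp: inversions_def)
      then show False using min x l by fastforce
    qed
    define u where "u = apply_swap a b v"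
    have u: "distinct u" "set u = set v"
      using apply_swap_vote[OF ab'(1,4)] less.prems by (auto simp: u_def)
    have inv: "inversions u S = inversions v S - {(a, b)}"
    proof -
      have "(c, d) \<in> inversions u S \<longleftrightarrow> (c, d) \<in> inversions v S - {(a, b)}" for c d
      proof (cases "c \<in> set v \<and> d \<in> set v \<and> c \<notin> S \<and> d \<in> S")
        case True
        have r: "rank c v = rank a v \<longleftrightarrow> c = a" "rank c v = rank b v \<longleftrightarrow> c = b"
          "rank d v = rank a v \<longleftrightarrow> d = a" "rank d v = rank b v \<longleftrightarrow> d = b"
          using True ab' by (simp_all add: rank_eq_iff)
        \<comment> \<open>Here \<open>c\<close> is outside \<open>S\<close> and \<open>d\<close>
          inside, so swapping \<open>a\<close> and \<open>b\<close> moves \<open>c\<close> only if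
          it is \<open>a\<close>, and \<open>d\<close> only if it is \<open>b\<close>.\<close>
        have "c \<noteq> b" "d \<noteq> a" using True ab' by auto
        moreover have "rank x u = rank (Transposition.transpose a b x) v" for x
          by (simp add: u_def rank_apply_swap)
        ultimately show ?thesis
          using True ab' adj r by (cases "c = a"; cases "d = b") (auto simp: inversions_def u)
      next
        case False
        then show ?thesis using less.prems by (auto simp: inversions_def u)
      qed
      then show ?thesis by auto
    qed
    have "card (inversions u S) < card (inversions v S)" unfolding inv
      using ab finite_inversions[OF less.prems(2)] by (intro psubset_card_mono) auto
    from less.hyps[OF this] u less.prems obtain xs w where xs: "distinct xs"
      "set xs = inversions u S" "apply_swaps xs u = Some w" "distinct w" "set w = set u"
      "inversions w S = {}" by auto
    have "admissible_swap v a b" using ab' adj by (simp add: admissible_swap_def)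
    then show ?thesis using xs inv ab u
      by (intro exI[of _ "(a, b) # xs"] exI[of _ w]) (auto simp: u_def)
  qed
qed

text \<open>Suppose \<open>c\<close> in \<open>S\<close> is missing from the first
  \<open>card S\<close> positions. Whoever stands there is ahead of \<open>c\<close>, hence in
  \<open>S\<close> for lack of inversions; so \<open>card S\<close> candidates would form a proper
  subset of \<open>S\<close>.\<close>

lemma top_of_no_inversions:
  assumes w: "distinct w" "S \<subseteq> set w" "inversions w S = {}"
  shows "set (take (card S) w) = S"
proof -
  let ?T = "set (take (card S) w)"
  have fin: "finite S" using w finite_subset by auto
  have "card S \<le> length w" using w card_mono[of "set w" S] distinct_card by fastforce
  then have cT: "card ?T = card S" using w by (simp add: distinct_card)
  have "S \<subseteq> ?T"
  proof
    fix c assume c: "c \<in> S"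
    show "c \<in> ?T"
    proof (rule ccontr)
      assume nc: "c \<notin> ?T"
      have "?T \<subseteq> S"
      proof
        fix x assume x: "x \<in> ?T"
        then have xw: "x \<in> set w" by (meson in_set_takeD)
        have "rank x w < rank c w"
          using rank_le_iff[OF w(1), of x "card S"] rank_le_iff[OF w(1), of c "card S"] x xw c nc w(2)
          by auto
        then show "x \<in> S" using w(3) c xw by (auto simp: inversions_def)
      qed
      then have sub: "?T \<subset> S" using c nc by blast
      then show False using psubset_card_mono[OF fin sub] cT by simp
    qed
  qed
  then show ?thesis using card_subset_eq[of ?T S] cT by simp
qed

text \<open>The least cost of a swap set that makes \<open>S\<close> the top:
  \<open>top_cost_le\<close> is the lower bound and \<open>top_cost_attained\<close> the matching
  construction.\<close>

definition top_cost :: "('a \<Rightarrow> 'a \<Rightarrow> nat) \<Rightarrow> 'a vote \<Rightarrow> 'a set \<Rightarrow> nat" where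
  "top_cost c v S = (\<Sum>(a, b) \<in> inversions v S. c a b)"

text \<open>An outsider ahead of a member of the final top set ends up behind it, and only the swap
  of that very pair reverses them. So \<open>X\<close> contains every inversion, and costs are not
  negative.\<close>

lemma top_cost_le:
  assumes "vote_after X v w" "distinct v" "finite X"
  shows "distinct w \<and> set w = set v \<and> top_cost c v (set (take k w)) \<le> (\<Sum>(a, b)\<in>X. c a b)"
proof -
  from assms obtain xs where xs: "set xs = X" "apply_swaps xs v = Some w"
    by (auto simp: vote_after_def)
  note r = apply_swaps_reversed[OF xs(2) assms(2)]
  let ?S = "set (take k w)"
  have "inversions v ?S \<subseteq> X"
  proof clarify
    fix a b assume ab: "(a, b) \<in> inversions v ?S"
    then have m: "a \<in> set w" "b \<in> set w" "a \<notin> ?S" "b \<in> ?S" "rank a v < rank b v"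
      using r by (auto simp: inversions_def dest: in_set_takeD)
    then have "rank b w < rank a w"
      using r rank_le_iff[of w a k] rank_le_iff[of w b k] by auto
    then show "(a, b) \<in> X" using r m xs by auto
  qed
  then show ?thesis using r assms(3) unfolding top_cost_def by (auto intro: sum_mono2)
qed

lemma top_cost_attained:
  assumes "distinct v" "S \<subseteq> set v"
  shows "\<exists>w. vote_after (inversions v S) v w \<and> distinct w \<and> set w = set v \<and>
    set (take (card S) w) = S"
proof -
  from swaps_to_top[OF assms] obtain xs w where "distinct xs" "set xs = inversions v S"
    "apply_swaps xs v = Some w" "distinct w" "set w = set v" "inversions w S = {}" by blast
  then show ?thesis using top_of_no_inversions[of w S] assms(2) unfolding vote_after_def by metis
qed

section \<open>From admissible swaps to top sets\<close>

lemma approval_score_card: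
  assumes "\<forall>i < length W. distinct (W ! i) \<and> c \<in> set (W ! i)"
  shows "approval_score k W c = card {i. i < length W \<and> c \<in> set (take k (W ! i))}"
proof -
  have "approval_score k W c = (\<Sum>i<length W. if rank c (W ! i) \<le> k then 1 else 0)"
    by (simp add: approval_score_def sum_list_sum_nth atLeast0LessThan)
  also have "\<dots> = (\<Sum>i<length W. if c \<in> set (take k (W ! i)) then 1 else 0)"
    using assms by (intro sum.cong) (auto simp: rank_le_iff)
  also have "\<dots> = card {i \<in> {..<length W}. c \<in> set (take k (W ! i))}"
    by (simp flip: sum.inter_filter)
  finally show ?thesis by simp
qed

definition score_in :: "nat \<Rightarrow> (nat \<Rightarrow> 'a set) \<Rightarrow> 'a \<Rightarrow> nat" where
  "score_in n S c = card {i. i < n \<and> c \<in> S i}"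

definition good_tops :: "'a set \<Rightarrow> 'a vote list \<Rightarrow> 'a \<Rightarrow> (nat \<Rightarrow> 'a \<Rightarrow> 'a \<Rightarrow> nat) \<Rightarrow> nat \<Rightarrow>
    nat \<Rightarrow> (nat \<Rightarrow> 'a set) \<Rightarrow> bool" where
  "good_tops C V p cost \<beta> k S \<longleftrightarrow>
     (\<forall>i < length V. S i \<subseteq> C \<and> card (S i) = k) \<and>
     (\<Sum>i<length V. top_cost (cost i) (V ! i) (S i)) \<le> \<beta> \<and>
     (\<forall>c \<in> C. score_in (length V) S c \<le> score_in (length V) S p)"

text \<open>Scores see only the top sets, and the cost of a swap set splits over the votes. The
  condition on \<open>k\<close> gives each top set exactly \<open>k\<close> members.\<close>

lemma swap_bribery_iff_good_tops:
  assumes el: "is_election C V" and p: "p \<in> C" and k: "k \<le> card C"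
  shows "swap_bribery (approval k) C V p cost \<beta> \<longleftrightarrow> (\<exists>S. good_tops C V p cost \<beta> k S)"
proof -
  let ?n = "length V"
  have v: "distinct (V ! i)" "set (V ! i) = C" if "i < ?n" for i
  proof -
    have "V ! i \<in> permutations_of_set C" using el nth_mem[OF that] by (auto simp: is_election_def)
    then show "distinct (V ! i)" "set (V ! i) = C" by (auto simp: permutations_of_set_def)
  qed
  have fin: "finite C" using el by (simp add: is_election_def)
  have app: "p \<in> approval k C W \<longleftrightarrow> (\<forall>c \<in> C. score_in ?n S c \<le> score_in ?n S p)"
    if "length W = ?n" "\<forall>i<?n. distinct (W ! i) \<and> set (W ! i) = C \<and> S i = set (take k (W ! i))"
    for W S
  proof -
    have "approval_score k W c = score_in ?n S c" if c: "c \<in> C" for c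
    proof -
      have "approval_score k W c = card {i. i < length W \<and> c \<in> set (take k (W ! i))}"
        using that \<open>length W = ?n\<close> \<open>\<forall>i<?n. _ i\<close> by (intro approval_score_card) auto
      also have "{i. i < length W \<and> c \<in> set (take k (W ! i))} = {i. i < ?n \<and> c \<in> S i}"
        using \<open>length W = ?n\<close> \<open>\<forall>i<?n. _ i\<close> by auto
      finally show ?thesis by (simp add: score_in_def)
    qed
    then show ?thesis using p by (auto simp: approval_def)
  qed
  have sumG: "(\<Sum>(i, a, b)\<in>\<Gamma>. cost i a b) = (\<Sum>i<?n. \<Sum>(a, b)\<in>{(a, b). (i, a, b) \<in> \<Gamma>}. cost i a b)"
    and finG: "\<And>i. finite {(a, b). (i, a, b) \<in> \<Gamma>}"
    if G: "\<Gamma> \<subseteq> {..<?n} \<times> C \<times> C" for \<Gamma>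
  proof -
    show f: "finite {(a, b). (i, a, b) \<in> \<Gamma>}" for i
      by (rule finite_subset[of _ "C \<times> C"]) (use G fin in auto)
    have "\<Gamma> = Sigma {..<?n} (\<lambda>i. {(a, b). (i, a, b) \<in> \<Gamma>})" using G by auto
    then have "(\<Sum>(i, a, b)\<in>\<Gamma>. cost i a b) =
        (\<Sum>(i, a, b)\<in>Sigma {..<?n} (\<lambda>i. {(a, b). (i, a, b) \<in> \<Gamma>}). cost i a b)" by simp
    also have "\<dots> = (\<Sum>i<?n. \<Sum>(a, b)\<in>{(a, b). (i, a, b) \<in> \<Gamma>}. cost i a b)"
      using f by (subst sum.Sigma) auto
    finally show "(\<Sum>(i, a, b)\<in>\<Gamma>. cost i a b) = (\<Sum>i<?n. \<Sum>(a, b)\<in>{(a, b). (i, a, b) \<in> \<Gamma>}. cost i a b)" .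
  qed
  show ?thesis
  proof
    assume "swap_bribery (approval k) C V p cost \<beta>"
    then obtain \<Gamma> W where G: "\<Gamma> \<subseteq> {..<?n} \<times> C \<times> C" and W: "length W = ?n"
      "\<And>i. i < ?n \<Longrightarrow> vote_after {(a, b). (i, a, b) \<in> \<Gamma>} (V ! i) (W ! i)"
      and cost: "(\<Sum>(i, a, b)\<in>\<Gamma>. cost i a b) \<le> \<beta>" and win: "p \<in> approval k C W"
      by (auto simp: swap_bribery_def votes_after_def)
    define S where "S i = set (take k (W ! i))" for i
    have Wi: "distinct (W ! i) \<and> set (W ! i) = C \<and> top_cost (cost i) (V ! i) (S i) \<le>
      (\<Sum>(a, b)\<in>{(a, b). (i, a, b) \<in> \<Gamma>}. cost i a b)" if "i < ?n" for i
      using top_cost_le[OF W(2)[OF that] v(1)[OF that] finG[OF G]] v(2)[OF that] by (simp add: S_def)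
    have "good_tops C V p cost \<beta> k S" unfolding good_tops_def
    proof (intro conjI allI impI)
      fix i assume i: "i < ?n"
      show "S i \<subseteq> C" using Wi[OF i] by (auto simp: S_def dest: in_set_takeD)
      have "length (W ! i) = card C" using Wi[OF i] distinct_card by fastforce
      then show "card (S i) = k" using Wi[OF i] k by (simp add: S_def distinct_card)
    next
      have "(\<Sum>i<?n. top_cost (cost i) (V ! i) (S i)) \<le>
        (\<Sum>i<?n. \<Sum>(a, b)\<in>{(a, b). (i, a, b) \<in> \<Gamma>}. cost i a b)"
        using Wi by (intro sum_mono) simp
      then show "(\<Sum>i<?n. top_cost (cost i) (V ! i) (S i)) \<le> \<beta>" using cost sumG[OF G] by simp
      show "\<forall>c \<in> C. score_in ?n S c \<le> score_in ?n S p"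
        using app[OF W(1), of S] Wi win by (simp add: S_def)
    qed
    then show "\<exists>S. good_tops C V p cost \<beta> k S" by blast
  next
    assume "\<exists>S. good_tops C V p cost \<beta> k S"
    then obtain S where S: "\<And>i. i < ?n \<Longrightarrow> S i \<subseteq> C \<and> card (S i) = k"
      and cost: "(\<Sum>i<?n. top_cost (cost i) (V ! i) (S i)) \<le> \<beta>"
      and win: "\<forall>c \<in> C. score_in ?n S c \<le> score_in ?n S p" by (auto simp: good_tops_def)
    \<comment> \<open>The cheapest realisation: in each vote exactly the inverted pairs.\<close>
    define \<Gamma> where "\<Gamma> = Sigma {..<?n} (\<lambda>i. inversions (V ! i) (S i))"
    have G: "\<Gamma> \<subseteq> {..<?n} \<times> C \<times> C" using S v by (auto simp: \<Gamma>_def inversions_def)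
    have Gi: "{(a, b). (i, a, b) \<in> \<Gamma>} = inversions (V ! i) (S i)" if "i < ?n" for i
      using that by (auto simp: \<Gamma>_def)
    have "\<forall>i. \<exists>w. i < ?n \<longrightarrow> vote_after (inversions (V ! i) (S i)) (V ! i) w \<and> distinct w \<and>
      set w = C \<and> set (take k w) = S i"
      using top_cost_attained v S by metis
    then obtain f where f: "\<And>i. i < ?n \<Longrightarrow> vote_after (inversions (V ! i) (S i)) (V ! i) (f i) \<and>
      distinct (f i) \<and> set (f i) = C \<and> set (take k (f i)) = S i" by metis
    define W where "W = map f [0..<?n]"
    have "votes_after \<Gamma> V W" using f Gi by (simp add: votes_after_def W_def)
    moreover have "(\<Sum>(i, a, b)\<in>\<Gamma>. cost i a b) \<le> \<beta>"
      using cost unfolding sumG[OF G] top_cost_def by (simp add: Gi)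
    moreover have "p \<in> approval k C W" using app[of W S] f win by (simp add: W_def)
    ultimately show "swap_bribery (approval k) C V p cost \<beta>"
      using G unfolding swap_bribery_def by blast
  qed
qed

text \<open>Every voter approves of every candidate, so \<open>p\<close> wins without any
  swap.\<close>

lemma swap_bribery_trivial:
  assumes el: "is_election C V" and p: "p \<in> C" and k: "card C \<le> k"
  shows "swap_bribery (approval k) C V p cost \<beta>"
proof -
  have v: "distinct v" "set v = C" if "v \<in> set V" for v
    using el that by (auto simp: is_election_def permutations_of_set_def)
  have "approval_score k V c = length V" if "c \<in> C" for c
  proof -
    have "(\<Sum>v\<leftarrow>V. if rank c v \<le> k then 1 else (0::nat)) = (\<Sum>v\<leftarrow>V. 1)"
      using v that k rank_le_length[of c] distinct_card
      by (intro arg_cong[of _ _ sum_list] map_cong) fastforce+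
    then show ?thesis by (simp add: approval_score_def sum_list_triv)
  qed
  then have "p \<in> approval k C V" using p by (simp add: approval_def)
  moreover have "votes_after {} V V" by (auto simp: votes_after_def vote_after_def)
  ultimately show ?thesis unfolding swap_bribery_def
    by (intro exI[of _ "{}"] exI[of _ V]) auto
qed

section \<open>Petals and replacement of top sets\<close>

text \<open>The sum in the order in which the program computes it: for each entry of
  \<open>T\<close>, walk down the vote until the entry is reached.\<close>

definition list_cost :: "('a \<Rightarrow> 'a \<Rightarrow> nat) \<Rightarrow> 'a vote \<Rightarrow> 'a list \<Rightarrow> nat" where
  "list_cost c v T =
     (\<Sum>e<length T. \<Sum>r<rank (T ! e) v - 1. if v ! r \<in> set T then 0 else c (v ! r) (T ! e))"

lemma list_cost_eq_top_cost:
  assumes v: "distinct v" and T: "distinct T" "set T \<subseteq> set v"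
  shows "list_cost c v T = top_cost c v (set T)"
proof -
  have inner: "(\<Sum>r<rank b v - 1. if v ! r \<in> set T then 0 else c (v ! r) b) =
      (\<Sum>a | a \<in> set v - set T \<and> rank a v < rank b v. c a b)" if b: "b \<in> set v" for b
  proof -
    \<comment> \<open>Counted from 0, the positions in front of \<open>b\<close> are those below
      \<open>rank b v - 1\<close>.\<close>
    have bij: "bij_betw ((!) v) {..<rank b v - 1} {a \<in> set v. rank a v < rank b v}"
    proof (rule bij_betw_byWitness[where f' = "\<lambda>a. rank a v - 1"])
      show "\<forall>r\<in>{..<rank b v - 1}. rank (v ! r) v - 1 = r"
        using rank_nth[OF v] rank_le_length[OF b] by auto
      show "\<forall>a\<in>{a \<in> set v. rank a v < rank b v}. v ! (rank a v - 1) = a"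
        using nth_rank by auto
      show "(!) v ` {..<rank b v - 1} \<subseteq> {a \<in> set v. rank a v < rank b v}"
        using rank_nth[OF v] rank_le_length[OF b] by auto
      show "(\<lambda>a. rank a v - 1) ` {a \<in> set v. rank a v < rank b v} \<subseteq> {..<rank b v - 1}"
      proof clarify
        fix a assume "rank a v < rank b v"
        then show "rank a v - 1 < rank b v - 1" using rank_pos[of a v] by linarith
      qed
    qed
    have "(\<Sum>r<rank b v - 1. if v ! r \<in> set T then 0 else c (v ! r) b) =
       (\<Sum>a | a \<in> set v \<and> rank a v < rank b v. if a \<in> set T then 0 else c a b)"
      using sum.reindex_bij_betw[OF bij, of "\<lambda>a. if a \<in> set T then 0 else c a b"] by simp
    also have "\<dots> = (\<Sum>a | a \<in> set v - set T \<and> rank a v < rank b v. c a b)"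
      by (rule sum.mono_neutral_cong_right) auto
    finally show ?thesis .
  qed
  have "list_cost c v T = (\<Sum>e<length T. \<Sum>a | a \<in> set v - set T \<and> rank a v < rank (T ! e) v. c a (T ! e))"
    unfolding list_cost_def using T by (intro sum.cong refl inner) auto
  also have "\<dots> = (\<Sum>b\<in>set T. \<Sum>a | a \<in> set v - set T \<and> rank a v < rank b v. c a b)"
    by (rule sum.reindex_bij_betw[OF bij_betw_nth[OF T(1) refl refl]])
  also have "\<dots> = (\<Sum>(b, a)\<in>Sigma (set T) (\<lambda>b. {a \<in> set v - set T. rank a v < rank b v}). c a b)"
    by (subst sum.Sigma) auto
  also have "\<dots> = top_cost c v (set T)" unfolding top_cost_def
    by (rule sum.reindex_bij_witness[of _ "\<lambda>(a, b). (b, a)" "\<lambda>(b, a). (a, b)"])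
       (auto simp: inversions_def)
  finally show ?thesis .
qed

text \<open>The states of a linear minimum search; the program keeps them in \<open>fd\<close>,
  \<open>bc\<close> and \<open>bT\<close>. The initial value 0 is a placeholder, shielded by
  \<open>found\<close> until the first hit.\<close>

fun scan :: "(nat \<Rightarrow> 'b) \<Rightarrow> ('b \<Rightarrow> bool) \<Rightarrow> ('b \<Rightarrow> nat) \<Rightarrow> 'b \<Rightarrow> nat \<Rightarrow> bool \<times> nat \<times> 'b" where
  "scan x P f d 0 = (False, 0, d)"
| "scan x P f d (Suc v) = (case scan x P f d v of (found, c, t) \<Rightarrow>
     if P (x v) \<and> (\<not> found \<or> f (x v) < c) then (True, f (x v), x v) else (found, c, t))"

lemma scan_correct:
  "case scan x P f d N of (found, c, t) \<Rightarrow>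
     if found then (\<exists>v < N. t = x v) \<and> P t \<and> c = f t \<and> (\<forall>v < N. P (x v) \<longrightarrow> c \<le> f (x v))
     else t = d \<and> c = 0 \<and> (\<forall>v < N. \<not> P (x v))"
proof (induction N)
  case (Suc N)
  then show ?case
    by (cases "scan x P f d N") (auto simp: less_Suc_eq split: if_splits intro: order_trans)
qed simp

text \<open>If \<open>k\<close> is at least the number of candidates, then
  \<open>swap_bribery_trivial\<close> applies; the first test of the program separates this
  case.\<close>

locale bribery =
  fixes k :: nat and I :: bribery_instance
  assumes k_pos: "1 \<le> k" and k_less: "k < num_cands I" and valid: "valid_instance I"
begin

abbreviation n :: nat where "n \<equiv> num_votes I"
abbreviation m :: nat where "m \<equiv> num_cands I"
abbreviation p :: nat where "p \<equiv> preferred I"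

lemma n_pos: "0 < n" and m_pos: "0 < m" and p_less: "p < m"
  using valid k_less by (auto simp: valid_instance_def num_votes_def)

lemma vote: "i < n \<Longrightarrow> distinct (votes I ! i)" "i < n \<Longrightarrow> set (votes I ! i) = {..<m}"
  "i < n \<Longrightarrow> length (votes I ! i) = m"
proof -
  assume i: "i < n"
  then have "votes I ! i \<in> permutations_of_set {..<m}" using valid nth_mem[of i "votes I"]
    by (auto simp: valid_instance_def is_election_def num_votes_def)
  then show *: "distinct (votes I ! i)" "set (votes I ! i) = {..<m}"
    by (auto simp: permutations_of_set_def)
  show "length (votes I ! i) = m" using distinct_card[OF *(1)] *(2) by simp
qed

text \<open>Tuples with repeated entries are enumerated as well and left to \<open>admits\<close> to
  discard, so that the enumeration is a plain count up to \<open>m ^ k\<close>.\<close>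

definition tuple :: "nat \<Rightarrow> nat list" where
  "tuple v = map (digit m v) [0..<k]"

lemma length_tuple [simp]: "length (tuple v) = k"
  by (simp add: tuple_def)

lemma set_tuple: "set (tuple v) \<subseteq> {..<m}"
  using digit_less[OF m_pos] by (auto simp: tuple_def)

lemma tuple_surj:
  assumes "length T = k" "set T \<subseteq> {..<m}"
  shows "\<exists>v < m ^ k. tuple v = T"
proof -
  have "\<forall>e < k. T ! e < m" using assms nth_mem by blast
  from digits_surj[OF this] obtain v where "v < m ^ k" "\<forall>e < k. digit m v e = T ! e" by blast
  then show ?thesis using assms by (intro exI[of _ v]) (auto simp: tuple_def intro!: nth_equalityI)
qed

definition admits :: "nat list \<Rightarrow> nat set \<Rightarrow> nat list \<Rightarrow> bool" where
  "admits A Z T \<longleftrightarrow> distinct T \<and>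
     (\<forall>e < k. if e < length A then T ! e = A ! e else T ! e \<notin> Z)"

abbreviation cost_of :: "nat \<Rightarrow> nat list \<Rightarrow> nat" where
  "cost_of i \<equiv> list_cost (swap_cost I i) (votes I ! i)"

abbreviation set_cost :: "nat \<Rightarrow> nat set \<Rightarrow> nat" where
  "set_cost i \<equiv> top_cost (swap_cost I i) (votes I ! i)"

definition search :: "nat \<Rightarrow> nat list \<Rightarrow> nat set \<Rightarrow> nat \<Rightarrow> bool \<times> nat \<times> nat list" where
  "search i A Z = scan tuple (admits A Z) (cost_of i) (replicate k p)"

text \<open>If no tuple is admitted then \<open>cheapest\<close> is the junk value \<open>replicate k p\<close>.\<close>

definition cheapest :: "nat \<Rightarrow> nat list \<Rightarrow> nat set \<Rightarrow> nat list" where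
  "cheapest i A Z = snd (snd (search i A Z (m ^ k)))"

lemma search_range:
  "length (snd (snd (search i A Z N))) = k" "set (snd (snd (search i A Z N))) \<subseteq> {..<m}"
proof -
  obtain fd c t where s: "search i A Z N = (fd, c, t)" by (cases "search i A Z N") auto
  then have "t = replicate k p \<or> (\<exists>v. t = tuple v)"
    using scan_correct[where x = tuple and P = "admits A Z" and f = "cost_of i" and d = "replicate k p" and N = N]
    by (auto simp: search_def split: if_splits)
  then have "length t = k \<and> set t \<subseteq> {..<m}"
    using p_less set_tuple by (elim disjE exE) (auto simp: set_replicate_conv_if)
  then show "length (snd (snd (search i A Z N))) = k"
    "set (snd (snd (search i A Z N))) \<subseteq> {..<m}" using s by auto
qed

lemma cheapest_correct:
  assumes T: "length T = k" "set T \<subseteq> {..<m}" "admits A Z T"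
  shows "admits A Z (cheapest i A Z) \<and> cost_of i (cheapest i A Z) \<le> cost_of i T"
proof -
  obtain v where "v < m ^ k" "tuple v = T" using tuple_surj T by blast
  then show ?thesis using T scan_correct[where x = tuple and P = "admits A Z" and f = "cost_of i" and d = "replicate k p" and N = "m ^ k"]
    by (cases "search i A Z (m ^ k)") (auto simp: search_def cheapest_def split: if_splits)
qed

section \<open>Petals and the growth of a kernel\<close>

definition petal_count :: nat where
  "petal_count = (n - 1) * k + 1"

fun petals :: "nat \<Rightarrow> nat list \<Rightarrow> nat \<Rightarrow> nat list" where
  "petals i A 0 = []"
| "petals i A (Suc t) = petals i A t @ cheapest i A (set A \<union> set (petals i A t))"

lemma length_petals [simp]: "length (petals i A t) = t * k"
  by (induction t) (auto simp: cheapest_def search_range)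

lemma set_petals: "set (petals i A t) \<subseteq> {..<m}"
  using search_range by (induction t) (auto simp: cheapest_def)

text \<open>A choice \<open>d\<close> is a position in the concatenated petals; the extra last position is \<open>p\<close>.\<close>

definition pick :: "nat \<Rightarrow> nat list \<Rightarrow> nat \<Rightarrow> nat" where
  "pick i A d = (petals i A petal_count @ [p]) ! d"

abbreviation digits_base :: nat where
  "digits_base \<equiv> petal_count * k + 1"

definition grow :: "nat \<Rightarrow> nat list \<Rightarrow> nat list \<Rightarrow> nat list" where
  "grow i = foldl (\<lambda>A d. A @ [pick i A d])"

lemma pick_less: "d < digits_base \<Longrightarrow> pick i A d < m"
  using subsetD[OF set_petals nth_mem[of d "petals i A petal_count"]] p_less
  by (auto simp: pick_def nth_append less_Suc_eq)

lemma length_grow [simp]: "length (grow i A ds) = length A + length ds"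
  unfolding grow_def by (induction ds arbitrary: A) auto

lemma set_grow: "set ds \<subseteq> {..<digits_base} \<Longrightarrow> set A \<subseteq> {..<m} \<Longrightarrow> set (grow i A ds) \<subseteq> {..<m}"
  unfolding grow_def by (induction ds arbitrary: A) (auto simp: pick_less)

lemma set_grow_mono: "set A \<subseteq> set (grow i A ds)"
  unfolding grow_def
proof (induction ds arbitrary: A)
  case (Cons d ds)
  from Cons[of "A @ [pick i A d]"] show ?case by simp
qed simp

text \<open>The sunflower argument: \<open>S\<close> meets one of the petals outside the kernel \<open>A\<close>, or all petals
  are at most as expensive as \<open>S\<close> and one of them avoids \<open>Y\<close>.\<close>

lemma pick_exists:
  assumes i: "i < n" and A: "distinct A" "length A < k" "set A \<subseteq> S"
    and S: "S \<subseteq> {..<m}" "card S = k" and Y: "finite Y" "card Y < petal_count" "Y \<inter> S = {}"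
  shows "\<exists>d < digits_base. \<exists>S'. pick i A d \<notin> set A \<and> insert (pick i A d) (set A) \<subseteq> S' \<and>
    S' \<subseteq> {..<m} \<and> card S' = k \<and> set_cost i S' \<le> set_cost i S \<and> Y \<inter> S' = {}"
proof -
  let ?P = "\<lambda>t. petals i A t"
  define Tt where "Tt t = cheapest i A (set A \<union> set (?P t))" for t
  have T_sub: "set (Tt t) \<subseteq> set (?P petal_count)" if "t < petal_count" for t
  proof -
    have "set (?P s) \<subseteq> set (?P u)" if "s \<le> u" for s u
      using that by (induction rule: dec_induct) auto
    from this[of "Suc t" petal_count] that show ?thesis by (auto simp: Tt_def)
  qed
  have pick: "\<exists>d < digits_base. pick i A d = x" if "x \<in> set (?P petal_count)" for x
  proof -
    from that obtain d where "d < petal_count * k" "?P petal_count ! d = x"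
      by (auto simp: in_set_conv_nth)
    then show ?thesis by (intro exI[of _ d]) (auto simp: pick_def nth_append)
  qed
  have fS: "finite S" using S finite_subset by blast
  show ?thesis
  proof (cases "S \<inter> set (?P petal_count) \<subseteq> set A")
    \<comment> \<open>\<open>S\<close> meets a petal outside the kernel: it lends the next element
      and stays the reference set.\<close>
    case False
    then obtain x where "x \<in> S" "x \<in> set (?P petal_count)" "x \<notin> set A" by blast
    with pick[of x] show ?thesis using A S Y by blast
  next
    case True
    obtain xs where xs: "set xs = S - set A" "distinct xs"
      using finite_distinct_list[of "S - set A"] fS by auto
    have "length xs = k - length A"
      using xs A S distinct_card[of xs] distinct_card[of A] by (simp add: card_Diff_subset)
    then have AT: "length (A @ xs) = k" "set (A @ xs) = S" "distinct (A @ xs)" using xs A by auto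
    \<comment> \<open>Listed with the kernel first, \<open>S\<close> itself competes for every
      petal, as it meets none of them outside \<open>A\<close>. Hence each petal is genuine and no
      more expensive than \<open>S\<close>.\<close>
    have key: "admits A (set A \<union> set (?P t)) (Tt t) \<and> cost_of i (Tt t) \<le> cost_of i (A @ xs)"
      if t: "t < petal_count" for t unfolding Tt_def
    proof (rule cheapest_correct)
      have "set (?P s) \<subseteq> set (?P u)" if "s \<le> u" for s u
        using that by (induction rule: dec_induct) auto
      then have "set (?P t) \<subseteq> set (?P petal_count)" using t by simp
      then have "xs ! (e - length A) \<notin> set A \<union> set (?P t)" if "e < k" "\<not> e < length A" for e
      proof -
        have "xs ! (e - length A) \<in> S - set A"
          using xs(1) nth_mem[of "e - length A" xs] that \<open>length xs = _\<close> by auto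
        then show ?thesis using True \<open>set (?P t) \<subseteq> _\<close> by blast
      qed
      then show "admits A (set A \<union> set (?P t)) (A @ xs)"
        using AT by (auto simp: admits_def nth_append)
    qed (use AT S in auto)
    have lT: "length (Tt t) = k" "set (Tt t) \<subseteq> {..<m}" for t
      using search_range by (auto simp: Tt_def cheapest_def)
    have tk: "take (length A) (Tt t) = A" and dr: "set (drop (length A) (Tt t)) \<inter> (set A \<union> set (?P t)) = {}"
      and dT: "distinct (Tt t)" if t: "t < petal_count" for t
    proof -
      show "take (length A) (Tt t) = A"
        using key[OF t] lT[of t] A by (intro nth_equalityI) (auto simp: admits_def)
      show "distinct (Tt t)" using key[OF t] by (simp add: admits_def)
      show "set (drop (length A) (Tt t)) \<inter> (set A \<union> set (?P t)) = {}"
      proof -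
        have "x \<notin> set A \<union> set (?P t)" if x: "x \<in> set (drop (length A) (Tt t))" for x
        proof -
          from x obtain e where "e < k - length A" "x = Tt t ! (length A + e)"
            using lT[of t] by (auto simp: in_set_conv_nth)
          then show ?thesis using key[OF t] unfolding admits_def
            by (metis add.commute less_diff_conv not_add_less1)
        qed
        then show ?thesis by blast
      qed
    qed
    have split: "set (Tt t) = set A \<union> set (drop (length A) (Tt t))" if "t < petal_count" for t
      by (metis append_take_drop_id set_append tk that)
    \<comment> \<open>Pigeonhole: the petals are disjoint outside \<open>A\<close>, and
      \<open>Y\<close> avoids \<open>A\<close> because \<open>A\<close> lies in \<open>S\<close>. So
      an element of \<open>Y\<close> meets at most one petal, and there are more petals than
      elements of \<open>Y\<close>.\<close>
    have "\<exists>t < petal_count. Y \<inter> set (Tt t) = {}"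
    proof (rule ccontr)
      assume "\<not> ?thesis"
      then have "\<forall>t. \<exists>y. t < petal_count \<longrightarrow> y \<in> Y \<and> y \<in> set (Tt t)" by blast
      then obtain y where y: "\<And>t. t < petal_count \<Longrightarrow> y t \<in> Y \<and> y t \<in> set (Tt t)" by metis
      have neq: "y s \<noteq> y t" if st: "s < t" "t < petal_count" for s t
      proof
        assume eq: "y s = y t"
        have "set (?P (Suc s)) \<subseteq> set (?P t)"
          using st(1) by (induction rule: strict_inc_induct) auto
        then have "y s \<in> set (?P t)" using y[of s] st by (auto simp: Tt_def)
        moreover have "y t \<notin> set A" using y[of t] st Y A by blast
        then have "y t \<in> set (drop (length A) (Tt t))" using split[of t] y[of t] st by blast
        ultimately show False using dr[of t] st eq by auto
      qed
      have "inj_on y {..<petal_count}"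
        by (rule inj_onI) (metis neq lessThan_iff linorder_neqE_nat)
      then have "petal_count \<le> card Y"
        using card_inj_on_le[of y "{..<petal_count}" Y] y Y(1) by auto
      then show False using Y(2) by simp
    qed
    then obtain t where t: "t < petal_count" "Y \<inter> set (Tt t) = {}" by blast
    \<comment> \<open>The petal that avoids \<open>Y\<close> becomes the new reference set; any of
      its elements outside the kernel will do.\<close>
    have "drop (length A) (Tt t) \<noteq> []" using lT[of t] A by simp
    then obtain x where "x \<in> set (drop (length A) (Tt t))" by (meson last_in_set)
    then have x: "x \<in> set (Tt t)" "x \<notin> set A" using dr[OF t(1)] by (auto dest: in_set_dropD)
    obtain d where d: "d < digits_base" "pick i A d = x" using pick T_sub[OF t(1)] x by blast
    have "cost_of i (Tt t) = set_cost i (set (Tt t))"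
      using list_cost_eq_top_cost[OF vote(1)[OF i] dT[OF t(1)]] lT[of t] vote(2)[OF i] by simp
    moreover have "set (A @ xs) \<subseteq> set (votes I ! i)"
      by (simp only: AT(2) vote(2)[OF i] S)
    from list_cost_eq_top_cost[OF vote(1)[OF i] AT(3) this]
    have "cost_of i (A @ xs) = set_cost i S" by (simp only: AT(2))
    ultimately have "set_cost i (set (Tt t)) \<le> set_cost i S" using key[OF t(1)] by simp
    moreover have "card (set (Tt t)) = k" using dT[OF t(1)] lT[of t] by (simp add: distinct_card)
    ultimately show ?thesis using d x t lT[of t] split[OF t(1)]
      by (intro exI[of _ d] conjI exI[of _ "set (Tt t)"]) auto
  qed
qed

text \<open>The reference set \<open>S\<close> may change with every element added; what persists is
  that it contains the kernel, avoids \<open>Y\<close> and does not become more expensive. Once the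
  kernel has \<open>k\<close> elements, the two coincide.\<close>

lemma grow_exists:
  assumes "i < n" "distinct A" "length A \<le> k" "set A \<subseteq> S"
    "S \<subseteq> {..<m}" "card S = k" "finite Y" "card Y < petal_count" "Y \<inter> S = {}"
  shows "\<exists>ds. length ds = k - length A \<and> set ds \<subseteq> {..<digits_base} \<and> distinct (grow i A ds) \<and>
     set_cost i (set (grow i A ds)) \<le> set_cost i S \<and> Y \<inter> set (grow i A ds) = {}"
  using assms
proof (induction "k - length A" arbitrary: A S)
  case 0
  then have "set A = S" using distinct_card[of A] finite_subset[of S "{..<m}"]
    by (intro card_subset_eq) auto
  moreover have "grow i A [] = A" by (simp add: grow_def)
  ultimately show ?case using 0 by (intro exI[of _ "[]"]) simp
next
  case (Suc l)
  then have "length A < k" by simp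
  from pick_exists[OF Suc.prems(1,2) this Suc.prems(4-9)] obtain d S' where d: "d < digits_base"
    "pick i A d \<notin> set A" "insert (pick i A d) (set A) \<subseteq> S'" "S' \<subseteq> {..<m}" "card S' = k"
    "set_cost i S' \<le> set_cost i S" "Y \<inter> S' = {}" by blast
  have "\<exists>ds. length ds = k - length (A @ [pick i A d]) \<and> set ds \<subseteq> {..<digits_base} \<and>
     distinct (grow i (A @ [pick i A d]) ds) \<and>
     set_cost i (set (grow i (A @ [pick i A d]) ds)) \<le> set_cost i S' \<and>
     Y \<inter> set (grow i (A @ [pick i A d]) ds) = {}"
    by (rule Suc.hyps(1)) (use Suc d \<open>length A < k\<close> in auto)
  then obtain ds where ds: "length ds = k - length (A @ [pick i A d])" "set ds \<subseteq> {..<digits_base}"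
     "distinct (grow i (A @ [pick i A d]) ds)"
     "set_cost i (set (grow i (A @ [pick i A d]) ds)) \<le> set_cost i S'"
     "Y \<inter> set (grow i (A @ [pick i A d]) ds) = {}" by blast
  have "grow i A (d # ds) = grow i (A @ [pick i A d]) ds" by (simp add: grow_def)
  then show ?case using ds d \<open>length A < k\<close> by (intro exI[of _ "d # ds"]) auto
qed

text \<open>The growth does not control which members of \<open>S\<close> survive. Making
  \<open>p\<close> the first kernel element protects it.\<close>

lemma replacement_exists:
  assumes i: "i < n" and S: "S \<subseteq> {..<m}" "card S = k" and Y: "finite Y" "card Y < petal_count" "Y \<inter> S = {}"
  shows "\<exists>ds. length ds = k \<and> set ds \<subseteq> {..<digits_base} \<and> distinct (grow i [] ds) \<and>
     set_cost i (set (grow i [] ds)) \<le> set_cost i S \<and> Y \<inter> set (grow i [] ds) = {} \<and>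
     (p \<in> S \<longrightarrow> p \<in> set (grow i [] ds))"
proof (cases "p \<in> S")
  case False
  then show ?thesis using grow_exists[OF i, of "[]" S Y] S Y by auto
next
  case True
  with grow_exists[OF i, of "[p]" S Y] S Y k_pos obtain ds where ds: "length ds = k - 1"
    "set ds \<subseteq> {..<digits_base}" "distinct (grow i [p] ds)" "Y \<inter> set (grow i [p] ds) = {}"
    "set_cost i (set (grow i [p] ds)) \<le> set_cost i S" by auto
  \<comment> \<open>The index behind the last petal entry denotes \<open>p\<close>; spending the
    first choice on it leaves \<open>k - 1\<close> choices.\<close>
  have "pick i [] (petal_count * k) = p" by (simp add: pick_def nth_append)
  then have "grow i [] (petal_count * k # ds) = grow i [p] ds" by (simp add: grow_def)
  then show ?thesis using ds set_grow_mono[of "[p]" i ds] k_pos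
    by (intro exI[of _ "petal_count * k # ds"]) auto
qed

section \<open>From strings of choices to top sets and back\<close>

definition top_of :: "(nat \<Rightarrow> nat) \<Rightarrow> nat \<Rightarrow> nat list" where
  "top_of g i = grow i [] (map (\<lambda>j. g (i * k + j)) [0..<k])"

lemma length_top_of [simp]: "length (top_of g i) = k"
  by (simp add: top_of_def)

lemma set_top_of: "i < n \<Longrightarrow> \<forall>e < n * k. g e < digits_base \<Longrightarrow> set (top_of g i) \<subseteq> {..<m}"
  unfolding top_of_def
proof (rule set_grow)
  assume i: "i < n" and g: "\<forall>e < n * k. g e < digits_base"
  have "i * k + j < n * k" if "j < k" for j
  proof -
    have "i * k + j < Suc i * k" using that by simp
    also have "\<dots> \<le> n * k" using i by (intro mult_le_mono1) simp
    finally show ?thesis .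
  qed
  then show "set (map (\<lambda>j. g (i * k + j)) [0..<k]) \<subseteq> {..<digits_base}" using g by auto
qed simp

definition success :: "(nat \<Rightarrow> nat) \<Rightarrow> bool" where
  "success g \<longleftrightarrow> (\<forall>i < n. distinct (top_of g i)) \<and> (\<Sum>i<n. cost_of i (top_of g i)) \<le> budget I \<and>
     (\<forall>c < m. score_in n (\<lambda>i. set (top_of g i)) c \<le> score_in n (\<lambda>i. set (top_of g i)) p)"

abbreviation good :: "(nat \<Rightarrow> nat set) \<Rightarrow> bool" where
  "good \<equiv> good_tops {..<m} (votes I) p (swap_cost I) (budget I) k"

lemma good_def: "good S \<longleftrightarrow> (\<forall>i < n. S i \<subseteq> {..<m} \<and> card (S i) = k) \<and>
     (\<Sum>i<n. set_cost i (S i)) \<le> budget I \<and> (\<forall>c < m. score_in n S c \<le> score_in n S p)"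
  by (auto simp: good_tops_def num_votes_def)

lemma success_good:
  assumes g: "\<forall>e < n * k. g e < digits_base" and s: "success g"
  shows "good (\<lambda>i. set (top_of g i))"
  unfolding good_def
proof (intro conjI)
  show "\<forall>i<n. set (top_of g i) \<subseteq> {..<m} \<and> card (set (top_of g i)) = k"
    using set_top_of[OF _ g] s by (auto simp: success_def distinct_card)
  have "(\<Sum>i<n. set_cost i (set (top_of g i))) = (\<Sum>i<n. cost_of i (top_of g i))"
    using s set_top_of[OF _ g] vote
    by (intro sum.cong refl list_cost_eq_top_cost[symmetric]) (auto simp: success_def)
  then show "(\<Sum>i<n. set_cost i (set (top_of g i))) \<le> budget I" using s by (simp add: success_def)
qed (use s in \<open>auto simp: success_def\<close>)

text \<open>Some candidate is in the top set of the first vote, as \<open>n\<close> and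
  \<open>k\<close> are positive, and \<open>p\<close> scores no less than it.\<close>

lemma score_pos:
  assumes "good S"
  shows "1 \<le> score_in n S p"
proof -
  have "card (S 0) = k" "S 0 \<subseteq> {..<m}" using assms n_pos by (auto simp: good_def)
  then obtain x where x: "x \<in> S 0" "x < m" using k_pos by (metis card.empty equals0I lessThan_iff not_one_le_zero subsetD)
  have "0 < card {i. i < n \<and> x \<in> S i}" using x n_pos by (subst card_gt_0_iff) auto
  then show ?thesis using assms x by (fastforce simp: good_def score_in_def)
qed

lemma replace_one:
  assumes S: "good S" and i: "i < n"
  shows "\<exists>ds. length ds = k \<and> set ds \<subseteq> {..<digits_base} \<and> distinct (grow i [] ds) \<and>
    good (S(i := set (grow i [] ds)))"
proof -
  \<comment> \<open>Members of \<open>S i\<close> may return, since they gain no point by it, and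
    \<open>p\<close> may enter, since its points only help.\<close>
  define Y where "Y = (\<Union>j\<in>{..<n} - {i}. S j) - S i - {p}"
  have Si: "S j \<subseteq> {..<m}" "card (S j) = k" "finite (S j)" if "j < n" for j
    using S that finite_subset by (auto simp: good_def)
  have "card Y \<le> card (\<Union>j\<in>{..<n} - {i}. S j)"
    unfolding Y_def using Si by (intro card_mono) auto
  also have "\<dots> \<le> (\<Sum>j\<in>{..<n} - {i}. card (S j))" by (rule card_UN_le) simp
  also have "\<dots> = (n - 1) * k" using Si i by simp
  finally have cY: "card Y < petal_count" by (simp add: petal_count_def)
  have "finite Y" using Si by (auto simp: Y_def)
  from replacement_exists[OF i Si(1,2)[OF i] this cY] obtain ds where ds: "length ds = k"
    "set ds \<subseteq> {..<digits_base}" "distinct (grow i [] ds)" "Y \<inter> set (grow i [] ds) = {}"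
    "set_cost i (set (grow i [] ds)) \<le> set_cost i (S i)" "p \<in> S i \<longrightarrow> p \<in> set (grow i [] ds)"
    by (fastforce simp: Y_def)
  let ?X = "set (grow i [] ds)"
  let ?S = "S(i := ?X)"
  have le: "score_in n S p \<le> score_in n ?S p"
    unfolding score_in_def using ds(6) by (intro card_mono) auto
  have "good ?S" unfolding good_def
  proof (intro conjI allI impI)
    fix j assume "j < n"
    then show "?S j \<subseteq> {..<m}" "card (?S j) = k"
      using Si set_grow[OF ds(2), of "[]" i] ds by (auto simp: distinct_card)
  next
    have "(\<Sum>j<n. set_cost j (?S j)) \<le> (\<Sum>j<n. set_cost j (S j))"
      using ds by (intro sum_mono) auto
    then show "(\<Sum>j<n. set_cost j (?S j)) \<le> budget I" using S by (simp add: good_def)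
  next
    fix c assume c: "c < m"
    show "score_in n ?S c \<le> score_in n ?S p"
    proof (cases "c \<in> ?X \<and> c \<notin> S i \<and> c \<noteq> p")
      case True
      \<comment> \<open>A newcomer outside \<open>Y\<close> is in none of the other sets, so its
        only point comes from vote \<open>i\<close>.\<close>
      then have "{j. j < n \<and> c \<in> ?S j} \<subseteq> {i}" using ds(4) by (auto simp: Y_def split: if_splits)
      from card_mono[OF _ this] have "score_in n ?S c \<le> 1" by (simp add: score_in_def)
      then show ?thesis using score_pos[OF S] le by simp
    next
      case False
      then have "score_in n ?S c \<le> score_in n S c" if "c \<noteq> p"
        unfolding score_in_def using that by (intro card_mono) auto
      moreover have "score_in n S c \<le> score_in n S p" using S c by (simp add: good_def)
      ultimately show ?thesis using le by (cases "c = p") auto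
    qed
  qed
  then show ?thesis using ds by blast
qed

lemma good_success:
  assumes "good S"
  shows "\<exists>g. (\<forall>e < n * k. g e < digits_base) \<and> success g"
proof -
  \<comment> \<open>Votes are replaced one by one; each time the set to avoid is formed anew, from
    the sets already replaced and the original ones.\<close>
  have "\<exists>G S. good S \<and> (\<forall>i < j. length (G i) = k \<and> set (G i) \<subseteq> {..<digits_base} \<and>
     distinct (grow i [] (G i)) \<and> S i = set (grow i [] (G i)))" if "j \<le> n" for j
    using that
  proof (induction j)
    case 0
    then show ?case using assms by auto
  next
    case (Suc j)
    then obtain G S where S: "good S" and G: "\<forall>i < j. length (G i) = k \<and> set (G i) \<subseteq> {..<digits_base} \<and>
     distinct (grow i [] (G i)) \<and> S i = set (grow i [] (G i))" by auto
    from replace_one[OF S, of j] Suc.prems obtain ds where ds: "length ds = k" "set ds \<subseteq> {..<digits_base}"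
      "distinct (grow j [] ds)" and "good (S(j := set (grow j [] ds)))" by auto
    moreover obtain S' where S': "S' = S(j := set (grow j [] ds))" by blast
    ultimately have "good S'" by simp
    moreover have "S' i = set (grow i [] ((G(j := ds)) i))" if "i < Suc j" for i
      using that G S' by (auto simp: less_Suc_eq)
    moreover have "length ((G(j := ds)) i) = k \<and> set ((G(j := ds)) i) \<subseteq> {..<digits_base} \<and>
        distinct (grow i [] ((G(j := ds)) i))" if "i < Suc j" for i
      using that G ds by (cases "i = j") simp_all
    ultimately show ?case by blast
  qed
  from this[of n] obtain G S where S: "good S" and G: "\<And>i. i < n \<Longrightarrow> length (G i) = k \<and>
     set (G i) \<subseteq> {..<digits_base} \<and> distinct (grow i [] (G i)) \<and> S i = set (grow i [] (G i))" by auto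
  \<comment> \<open>One string for all votes, cut into blocks of length \<open>k\<close>.\<close>
  define g where "g e = G (e div k) ! (e mod k)" for e
  have top: "top_of g i = grow i [] (G i)" if "i < n" for i
  proof -
    have "map (\<lambda>j. g (i * k + j)) [0..<k] = G i"
      using G[OF that] by (intro nth_equalityI) (auto simp: g_def)
    then show ?thesis by (simp add: top_of_def)
  qed
  have "g e < digits_base" if "e < n * k" for e
  proof -
    have "e div k < n" using that by (simp add: less_mult_imp_div_less)
    moreover have "e mod k < k" using k_pos by simp
    ultimately have "g e \<in> set (G (e div k))" using G nth_mem by (simp add: g_def)
    then show ?thesis using G[OF \<open>e div k < n\<close>] by auto
  qed
  moreover have "success g" unfolding success_def
  proof (intro conjI)
    show "\<forall>i<n. distinct (top_of g i)" using top G by simp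
    have "(\<Sum>i<n. cost_of i (top_of g i)) = (\<Sum>i<n. set_cost i (S i))"
    proof (intro sum.cong refl)
      fix i assume "i \<in> {..<n}"
      then have i: "i < n" by simp
      then have "set (grow i [] (G i)) \<subseteq> {..<m}" using G set_grow[of "G i" "[]" i] by auto
      then show "cost_of i (top_of g i) = set_cost i (S i)"
        using G[OF i] top[OF i] list_cost_eq_top_cost[OF vote(1)[OF i]] vote(2)[OF i] by simp
    qed
    then show "(\<Sum>i<n. cost_of i (top_of g i)) \<le> budget I" using S by (simp add: good_def)
    have "score_in n (\<lambda>i. set (top_of g i)) c = score_in n S c" for c
    proof -
      have "{i. i < n \<and> c \<in> set (top_of g i)} = {i. i < n \<and> c \<in> S i}" using top G by auto
      then show ?thesis by (simp add: score_in_def)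
    qed
    then show "\<forall>c<m. score_in n (\<lambda>i. set (top_of g i)) c \<le> score_in n (\<lambda>i. set (top_of g i)) p"
      using S by (simp add: good_def)
  qed
  ultimately show ?thesis by blast
qed

text \<open>Soundness is cheap, since each string is tested in full; completeness is the replacement
  argument.\<close>

lemma bribery_iff_success:
  "approval_swap_bribery k I \<longleftrightarrow>
     (\<exists>v < digits_base ^ (n * k). success (digit digits_base v))"
proof -
  have el: "is_election {..<m} (votes I)" using valid by (simp add: valid_instance_def)
  \<comment> \<open>\<open>digits_surj\<close> reproduces a string only on its first
    \<open>n * k\<close> positions, so \<open>success\<close> has to be shown to depend on these
    alone.\<close>
  have cong: "success g = success h" if "\<forall>e < n * k. g e = h e" for g h
  proof -
    have "top_of g i = top_of h i" if i: "i < n" for i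
    proof -
      have "i * k + j < n * k" if "j < k" for j
      proof -
        have "i * k + j < Suc i * k" using that by simp
        also have "\<dots> \<le> n * k" using i by (intro mult_le_mono1) simp
        finally show ?thesis .
      qed
      then show ?thesis using \<open>\<forall>e < n * k. g e = h e\<close> by (auto simp: top_of_def intro!: arg_cong[of _ _ "grow i []"])
    qed
    moreover from this have "score_in n (\<lambda>i. set (top_of g i)) c = score_in n (\<lambda>i. set (top_of h i)) c" for c
      unfolding score_in_def by (intro arg_cong[of _ _ card]) auto
    ultimately show ?thesis by (simp add: success_def)
  qed
  have "approval_swap_bribery k I \<longleftrightarrow> (\<exists>S. good S)"
    unfolding approval_swap_bribery_def
    using swap_bribery_iff_good_tops[OF el, of p k] p_less k_less by simp
  also have "\<dots> \<longleftrightarrow> (\<exists>v < digits_base ^ (n * k). success (digit digits_base v))"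
  proof
    assume "\<exists>S. good S"
    then obtain g where g: "\<forall>e < n * k. g e < digits_base" "success g" using good_success by blast
    from digits_surj[OF g(1)] obtain v where "v < digits_base ^ (n * k)"
      "\<forall>e < n * k. digit digits_base v e = g e" by blast
    then show "\<exists>v < digits_base ^ (n * k). success (digit digits_base v)" using g(2) cong by blast
  next
    assume "\<exists>v < digits_base ^ (n * k). success (digit digits_base v)"
    then obtain v where "success (digit digits_base v)" by blast
    from success_good[OF _ this] show "\<exists>S. good S" using digit_less[of digits_base v] by (intro exI) simp
  qed
  finally show ?thesis .
qed

end

section \<open>The program\<close>

text \<open>The array \<open>T\<close> is the tuple under test, \<open>A\<close> the kernel with \<open>j\<close> elements, \<open>pk\<close> the
  concatenated petals, \<open>g\<close> the string of choices; \<open>fd\<close>, \<open>bc\<close>, \<open>bT\<close> are the result of a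
  minimum search.  The machine cannot multiply, so \<open>mm\<close> and \<open>mk\<close> are tables of the multiples
  of \<open>m\<close> and \<open>k\<close>.\<close>

definition mark_loop :: com where
  "mark_loop = For ''e'' (Val ''k'')
     (Seq (Cond (Less (Const 0) (Read ''ins'' (Read ''T'' (Val ''e'')))) (Put ''ok'' (Const 0)) Skip)
     (Seq (Cond (Less (Val ''e'') (Val ''j''))
            (Cond (Eq (Read ''T'' (Val ''e'')) (Read ''A'' (Val ''e''))) Skip (Put ''ok'' (Const 0)))
            (Cond (Less (Const 0) (Read ''mark'' (Read ''T'' (Val ''e'')))) (Put ''ok'' (Const 0)) Skip))
       (Assign ''ins'' (Read ''T'' (Val ''e'')) (Const 1))))"

abbreviation here :: aexp where
  "here \<equiv> Read ''vote'' (Plus (Read ''mm'' (Val ''i'')) (Val ''r''))"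

text \<open>The cost of \<open>(i, a, b)\<close> is at address \<open>i * m * m + a * m + b\<close>.
  Its first summand takes two look-ups in \<open>mm\<close>, which is why that table extends to
  \<open>n * m\<close>. The walk stops because every candidate occurs in the vote.\<close>

definition cost_loop :: com where
  "cost_loop = For ''e'' (Val ''k'')
     (Seq (Put ''r'' (Const 0))
       (While (Neg (Eq here (Read ''T'' (Val ''e''))))
         (Seq (Cond (Less (Const 0) (Read ''ins'' here)) Skip
                (Put ''c'' (Plus (Val ''c'') (Read ''cost''
                  (Plus (Plus (Read ''mm'' (Read ''mm'' (Val ''i''))) (Read ''mm'' here))
                    (Read ''T'' (Val ''e'')))))))
           (Put ''r'' (Plus (Val ''r'') (Const 1))))))"

text \<open>Only entries of \<open>T\<close> were marked, so unmarking them restores the all-zero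
  array from which the next tuple starts.\<close>

definition clear_loop :: com where
  "clear_loop = For ''e'' (Val ''k'') (Assign ''ins'' (Read ''T'' (Val ''e'')) (Const 0))"

definition check :: com where
  "check = Seq (Put ''ok'' (Const 1)) (Seq (Put ''c'' (Const 0))
     (Seq mark_loop (Seq cost_loop clear_loop)))"

lemma mods_check [simp]:
  "mods mark_loop = {''e'', ''ok'', ''ins''}" "mods cost_loop = {''e'', ''r'', ''c''}"
  "mods clear_loop = {''e'', ''ins''}" "mods check = {''e'', ''ok'', ''ins'', ''r'', ''c''}"
  by (auto simp: mark_loop_def cost_loop_def clear_loop_def check_def)

lemma flip_free_check [simp]: "flip_free check"
  by (simp add: mark_loop_def cost_loop_def clear_loop_def check_def)

section \<open>Testing one tuple: correctness and time\<close>

context bribery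
begin

text \<open>The part of the store that is fixed once the set-up is done. The range of
  \<open>mm\<close> allows for the double look-up; that of \<open>mk\<close> covers the petals and,
  by \<open>le_petal_count\<close>, the votes.\<close>

definition env :: "store \<Rightarrow> bool" where
  "env s \<longleftrightarrow> s ''n'' 0 = n \<and> s ''m'' 0 = m \<and> s ''k'' 0 = k \<and> s ''p'' 0 = p \<and> s ''beta'' 0 = budget I \<and>
     (\<forall>i < n. \<forall>r < m. s ''vote'' (i * m + r) = votes I ! i ! r) \<and>
     (\<forall>i < n. \<forall>a < m. \<forall>b < m. s ''cost'' (i * m * m + a * m + b) = swap_cost I i a b) \<and>
     (\<forall>x \<le> n * m. s ''mm'' x = x * m) \<and> (\<forall>x \<le> petal_count. s ''mk'' x = x * k) \<and>
     s ''L'' 0 = n * k \<and> s ''P'' 0 = petal_count \<and> s ''B'' 0 = digits_base"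

lemma env_cong:
  assumes "env s" and "\<forall>y \<in> {''n'', ''m'', ''k'', ''p'', ''beta'', ''vote'', ''cost'', ''mm'', ''mk'',
    ''L'', ''P'', ''B''}. s' y = s y"
  shows "env s'"
  using assms by (simp add: env_def)

definition scan_env :: "nat \<Rightarrow> nat list \<Rightarrow> nat set \<Rightarrow> store \<Rightarrow> bool" where
  "scan_env i A Z s \<longleftrightarrow> env s \<and> i < n \<and> s ''i'' 0 = i \<and> s ''j'' 0 = length A \<and> length A \<le> k \<and>
     (\<forall>e < length A. s ''A'' e = A ! e) \<and> (\<forall>x < m. 0 < s ''mark'' x \<longleftrightarrow> x \<in> Z)"

lemma scan_env_cong:
  assumes "scan_env i A Z s" and "\<forall>y \<in> {''n'', ''m'', ''k'', ''p'', ''beta'', ''vote'', ''cost'', ''mm'', ''mk'',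
    ''L'', ''P'', ''B'', ''i'', ''j'', ''A'', ''mark''}. s' y = s y"
  shows "scan_env i A Z s'"
  using assms env_cong[of s s'] by (simp add: scan_env_def)

definition holds_tuple :: "nat list \<Rightarrow> store \<Rightarrow> bool" where
  "holds_tuple T s \<longleftrightarrow> length T = k \<and> set T \<subseteq> {..<m} \<and> (\<forall>e < k. s ''T'' e = T ! e)"

lemma set_take_Suc: "e < length xs \<Longrightarrow> set (take (Suc e) xs) = insert (xs ! e) (set (take e xs))"
  by (simp add: take_Suc_conv_app_nth)

lemma wp_mark_loop:
  assumes S: "scan_env i A Z s" and T: "holds_tuple T s"
    and init: "s ''ok'' 0 = 1" "\<forall>x < m. s ''ins'' x = 0"
  shows "wp mark_loop (\<lambda>t s'. t \<le> 80 * k + 20 \<and> s' ''ok'' 0 = of_bool (admits A Z T) \<and>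
     (\<forall>x < m. s' ''ins'' x = of_bool (x \<in> set T))) s"
proof -
  let ?I = "\<lambda>e s'. s' ''ok'' 0 = of_bool (distinct (take e T) \<and>
      (\<forall>e' < e. if e' < length A then T ! e' = A ! e' else T ! e' \<notin> Z)) \<and>
     (\<forall>x < m. s' ''ins'' x = of_bool (x \<in> set (take e T)))"
  have T': "length T = k" "\<And>e. e < k \<Longrightarrow> T ! e < m \<and> s ''T'' e = T ! e"
    using T nth_mem by (fastforce simp: holds_tuple_def)+
  have S': "s ''k'' 0 = k" "s ''j'' 0 = length A" "\<And>e. e < length A \<Longrightarrow> s ''A'' e = A ! e"
    "\<And>x. x < m \<Longrightarrow> 0 < s ''mark'' x \<longleftrightarrow> x \<in> Z"
    using S by (auto simp: scan_env_def env_def)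
  show ?thesis unfolding mark_loop_def
  proof (rule wp_For[where N = k and I = ?I and T = 60], goal_cases)
    case (5 e s')
    have d: "distinct (take (Suc e) T) \<longleftrightarrow> distinct (take e T) \<and> T ! e \<notin> set (take e T)"
      using 5(1) T'(1) by (simp add: take_Suc_conv_app_nth)
    have fr: "s' ''T'' = s ''T''" "s' ''k'' = s ''k''" "s' ''j'' = s ''j''" "s' ''A'' = s ''A''"
      "s' ''mark'' = s ''mark''" using 5(4) by auto
    show ?case
      apply (intro wp_Seq wp_Cond wp_Assign wp_Skip)
      using 5(1-3) T' S' d set_take_Suc[of e T]
      by (auto simp: update_apply fr less_Suc_eq)
  next
    case (6 t s')
    then show ?case using T'(1) by (auto simp: admits_def algebra_simps)
  qed (use init S' in \<open>auto simp: update_apply\<close>)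
qed

lemma wp_cost_loop:
  assumes S: "scan_env i A Z s" and T: "holds_tuple T s"
    and init: "s ''c'' 0 = 0" "\<forall>x < m. s ''ins'' x = of_bool (x \<in> set T)"
  shows "wp cost_loop (\<lambda>t s'. t \<le> k * (m * 100 + 100) + 20 \<and> s' ''c'' 0 = cost_of i T) s"
proof -
  let ?v = "votes I ! i" and ?c = "swap_cost I i"
  let ?g = "\<lambda>e r. if ?v ! r \<in> set T then 0 else ?c (?v ! r) (T ! e)"
  have T': "length T = k" "\<And>e. e < k \<Longrightarrow> T ! e < m \<and> s ''T'' e = T ! e"
    using T nth_mem by (fastforce simp: holds_tuple_def)+
  have i: "i < n" using S by (simp add: scan_env_def)
  have iv: "i * m + r < n * m" if "r < m" for r
  proof -
    have "i * m + r < Suc i * m" using that by simp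
    also have "\<dots> \<le> n * m" using i by (intro mult_le_mono1) simp
    finally show ?thesis .
  qed
  have le: "a \<le> n * m" if "a < m" for a proof -
    have "m \<le> n * m" using n_pos by simp
    then show ?thesis using that by linarith
  qed
  have le': "i * m \<le> n * m" using i by simp
  moreover have "i \<le> i * m" using m_pos by simp
  ultimately have le'': "i \<le> n * m" by (rule order_trans[rotated])
  have S': "s ''k'' 0 = k" "s ''i'' 0 = i" "s ''mm'' i = i * m" "s ''mm'' (i * m) = i * m * m"
    "\<And>a. a < m \<Longrightarrow> s ''mm'' a = a * m"
    "\<And>r. r < m \<Longrightarrow> s ''vote'' (i * m + r) = ?v ! r"
    "\<And>a b. a < m \<Longrightarrow> b < m \<Longrightarrow> s ''cost'' (i * m * m + a * m + b) = ?c a b"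
    using S le le' le'' by (simp_all add: scan_env_def env_def)
  have v: "?v ! r < m" if "r < m" for r using vote[OF i] that nth_mem by fastforce
  show ?thesis unfolding cost_loop_def
  proof (rule wp_For[where N = k and T = "m * 100 + 60" and
        I = "\<lambda>e s'. s' ''c'' 0 = (\<Sum>e'<e. \<Sum>r<rank (T ! e') ?v - 1. ?g e' r)"], goal_cases)
    case (5 e s')
    note e = 5(1)
    have fr: "s' ''T'' = s ''T''" "s' ''k'' = s ''k''" "s' ''i'' = s ''i''" "s' ''vote'' = s ''vote''"
      "s' ''ins'' = s ''ins''" "s' ''mm'' = s ''mm''" "s' ''cost'' = s ''cost''" using 5(4) by auto
    \<comment> \<open>The position of the entry in the vote, counted from 0, and so the number of
      rounds of the inner loop.\<close>
    define R where "R = rank (T ! e) ?v - 1"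
    have mem: "T ! e \<in> set ?v" using T'(2)[OF e] vote(2)[OF i] by simp
    have R: "R < m" "?v ! R = T ! e"
      using rank_le_length[OF mem] rank_pos[of "T ! e" ?v] nth_rank[OF mem] vote(3)[OF i]
      by (auto simp: R_def)
    have Riff: "?v ! r = T ! e \<longleftrightarrow> r = R" if "r < m" for r
      using R that vote[OF i] nth_eq_iff_index_eq[of ?v r R] by auto
    let ?J = "\<lambda>r s''. s'' ''r'' 0 = r \<and> s'' ''e'' 0 = e \<and>
      s'' ''c'' 0 = (\<Sum>e'<e. \<Sum>r<rank (T ! e') ?v - 1. ?g e' r) + (\<Sum>r'<r. ?g e r') \<and>
      (\<forall>y. y \<notin> {''e'', ''r'', ''c''} \<longrightarrow> s'' y = s y)"
    show ?case
    proof (intro wp_Seq wp_Assign, rule wp_While[where N = R and T = 60 and I = ?J], goal_cases)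
      case 1
      then show ?case using 5 by (auto simp: update_apply)
    next
      case (2 r s'')
      then have "r < m" using R by simp
      moreover have "s'' ''T'' = s ''T''" "s'' ''i'' = s ''i''" "s'' ''vote'' = s ''vote''"
        "s'' ''mm'' = s ''mm''" using 2 by auto
      ultimately have "aval here s'' = ?v ! r" "aval (Read ''T'' (Val ''e'')) s'' = T ! e"
        using 2 S' T'(2)[OF e] by simp_all
      then have "bval (Neg (Eq here (Read ''T'' (Val ''e'')))) s'' \<longleftrightarrow> ?v ! r \<noteq> T ! e"
        by (auto simp del: aval.simps)
      moreover have "?v ! r \<noteq> T ! e \<longleftrightarrow> r < R" using Riff[OF \<open>r < m\<close>] 2(2) by linarith
      ultimately show ?case by (rule trans)
    next
      case (3 r s'')
      then have r: "r < m" using R by simp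
      have fr2: "s'' ''T'' = s ''T''" "s'' ''i'' = s ''i''" "s'' ''vote'' = s ''vote''"
        "s'' ''mm'' = s ''mm''" "s'' ''ins'' = s ''ins''" "s'' ''cost'' = s ''cost''" using 3 by auto
      show ?case
        apply (intro wp_Seq wp_Cond wp_Assign wp_Skip)
        using 3 S' v[OF r] T'(2)[OF e] init(2) r
        by (auto simp: update_apply fr2)
    next
      case (4 t s'')
      have "R * (60 + bcost (Neg (Eq here (Read ''T'' (Val ''e'')))) + 1) \<le> m * 100"
        using R by (intro mult_le_mono) auto
      then show ?case using 4 by (auto simp: R_def)
    qed
  next
    case (6 t s')
    then show ?case using T'(1) by (auto simp: list_cost_def algebra_simps)
  qed (use init S' in \<open>auto simp: update_apply\<close>)
qed

lemma wp_clear_loop: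
  assumes k: "s ''k'' 0 = k" and T: "holds_tuple T s"
    and init: "\<forall>x < m. s ''ins'' x = of_bool (x \<in> set T)"
  shows "wp clear_loop (\<lambda>t s'. t \<le> k * 30 + 20 \<and> (\<forall>x < m. s' ''ins'' x = 0)) s"
proof -
  have T': "length T = k" "\<And>e. e < k \<Longrightarrow> T ! e < m \<and> s ''T'' e = T ! e"
    using T nth_mem by (fastforce simp: holds_tuple_def)+
  show ?thesis unfolding clear_loop_def
  proof (rule wp_For[where N = k and T = 10 and
        I = "\<lambda>e s'. \<forall>x < m. s' ''ins'' x = of_bool (x \<in> set T \<and> x \<notin> set (take e T))"], goal_cases)
    case (5 e s')
    then have "s' ''T'' = s ''T''" by auto
    then show ?case using 5 T' set_take_Suc[of e T] by (intro wp_Assign) (auto simp: update_apply)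
  next
    case (6 t s')
    then show ?case using T'(1) by auto
  qed (use init k in \<open>auto simp: update_apply\<close>)
qed

lemma holds_tuple_cong: "holds_tuple T s \<Longrightarrow> s' ''T'' = s ''T'' \<Longrightarrow> holds_tuple T s'"
  by (simp add: holds_tuple_def)

lemma wp_check:
  assumes S: "scan_env i A Z s" and T: "holds_tuple T s" and init: "\<forall>x < m. s ''ins'' x = 0"
  shows "wp check (\<lambda>t s'. t \<le> 400 * (k * m) \<and> s' ''ok'' 0 = of_bool (admits A Z T) \<and>
     s' ''c'' 0 = cost_of i T \<and> (\<forall>x < m. s' ''ins'' x = 0)) s"
proof -
  \<comment> \<open>Enough to absorb the lower-order terms into a multiple of \<open>k * m\<close>;
    the same device recurs in the later time bounds.\<close>
  have km: "1 \<le> k * m" "k \<le> k * m" using k_pos m_pos by auto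
  show ?thesis unfolding check_def
  proof (intro wp_Seq wp_Assign, rule wp_frame[OF wp_mark_loop[of i A Z _ T]], goal_cases)
    case 1
    then show ?case by (rule scan_env_cong[OF S]) (simp add: update_apply)
  next
    case 2
    then show ?case by (rule holds_tuple_cong[OF T]) (simp add: update_apply)
  next
    case (5 t1 s1)
    then have t1: "t1 \<le> 80 * k + 20" "s1 ''ok'' 0 = of_bool (admits A Z T)"
      "\<forall>x < m. s1 ''ins'' x = of_bool (x \<in> set T)" and c1: "s1 ''c'' 0 = 0"
      and fr1: "\<forall>y. y \<notin> {''e'', ''ok'', ''ins'', ''c''} \<longrightarrow> s1 y = s y"
      by (auto simp: update_apply)
    show ?case
    proof (rule wp_Seq, rule wp_frame[OF wp_cost_loop[of i A Z _ T]], goal_cases)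
      case 1
      then show ?case by (rule scan_env_cong[OF S]) (simp add: fr1)
    next
      case 2
      then show ?case by (rule holds_tuple_cong[OF T]) (simp add: fr1)
    next
      case (5 t2 s2)
      then have t2: "t2 \<le> k * (m * 100 + 100) + 20" "s2 ''c'' 0 = cost_of i T"
        and fr2: "\<forall>y. y \<notin> {''e'', ''r'', ''c''} \<longrightarrow> s2 y = s1 y" by auto
      show ?case
      proof (rule wp_frame[OF wp_clear_loop[of _ T]], goal_cases)
        case 1
        then show ?case using S by (simp add: fr1 fr2 scan_env_def env_def)
      next
        case 2
        then show ?case by (rule holds_tuple_cong[OF T]) (simp add: fr1 fr2)
      next
        case 3
        then show ?case using t1 by (simp add: fr2)
      next
        case (4 t3 s3)
        then have t3: "t3 \<le> k * 30 + 20" "\<forall>x < m. s3 ''ins'' x = 0" "s3 ''ok'' = s1 ''ok''" "s3 ''c'' = s2 ''c''"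
          using fr2 by auto
        have "k * (m * 100 + 100) = 100 * (k * m) + 100 * k" by (simp add: algebra_simps)
        then have "t1 + (t2 + t3) + 6 \<le> 400 * (k * m)" using t1(1) t2(1) t3(1) km by linarith
        then show ?case using t1 t2 t3 by simp
      qed
    qed (use t1 c1 in simp_all)
  qed (use init in \<open>simp_all add: update_apply\<close>)
qed

end

text \<open>As \<open>bexp\<close> has no disjunction, the update test of \<open>scan\<close> is
  written by De Morgan's law. Filling \<open>bT\<close> with \<open>p\<close> sets up the junk value
  of \<open>search\<close>.\<close>

definition scan_loop :: com where
  "scan_loop = Seq (Put ''fd'' (Const 0)) (Seq (Put ''bc'' (Const 0))
     (Seq (For ''e'' (Val ''k'') (Assign ''bT'' (Val ''e'') (Val ''p'')))
       (Enum ''T'' ''h2'' ''go2'' (Val ''k'') (Val ''m'')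
         (Seq check
           (Cond (Conj (Less (Const 0) (Val ''ok''))
                   (Neg (Conj (Less (Const 0) (Val ''fd'')) (Neg (Less (Val ''c'') (Val ''bc''))))))
             (Seq (Put ''fd'' (Const 1)) (Seq (Put ''bc'' (Val ''c''))
               (For ''e'' (Val ''k'') (Assign ''bT'' (Val ''e'') (Read ''T'' (Val ''e''))))))
             Skip)))))"

lemma mods_scan_loop [simp]: "mods scan_loop =
    {''fd'', ''bc'', ''bT'', ''T'', ''h2'', ''go2'', ''e'', ''ok'', ''ins'', ''r'', ''c''}"
  by (auto simp: scan_loop_def)

lemma flip_free_scan_loop [simp]: "flip_free scan_loop"
  by (simp add: scan_loop_def)

text \<open>\<open>mark\<close> accumulates the kernel and the petals found so far. The last
  assignment puts \<open>p\<close> behind the last petal, where the extra choice looks for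
  it.\<close>

definition petal_loop :: com where
  "petal_loop = Seq (For ''x'' (Val ''m'') (Assign ''mark'' (Val ''x'') (Const 0)))
    (Seq (For ''e'' (Val ''j'') (Assign ''mark'' (Read ''A'' (Val ''e'')) (Const 1)))
    (Seq (For ''t'' (Val ''P'')
      (Seq scan_loop
        (For ''e'' (Val ''k'')
          (Seq (Assign ''pk'' (Plus (Read ''mk'' (Val ''t'')) (Val ''e'')) (Read ''bT'' (Val ''e'')))
            (Assign ''mark'' (Read ''bT'' (Val ''e'')) (Const 1))))))
      (Assign ''pk'' (Read ''mk'' (Val ''P'')) (Val ''p''))))"

lemma mods_petal_loop [simp]: "mods petal_loop =
    {''x'', ''mark'', ''t'', ''pk''} \<union> mods scan_loop"
  by (auto simp: petal_loop_def)

lemma flip_free_petal_loop [simp]: "flip_free petal_loop"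
  by (simp add: petal_loop_def)

section \<open>Minimum search and petals: correctness and time\<close>

context bribery
begin

definition best_is :: "bool \<times> nat \<times> nat list \<Rightarrow> store \<Rightarrow> bool" where
  "best_is b s \<longleftrightarrow> (case b of (found, c, T) \<Rightarrow>
     s ''fd'' 0 = of_bool found \<and> s ''bc'' 0 = c \<and> (\<forall>e < k. s ''bT'' e = T ! e))"

lemma wp_copy:
  assumes k: "s ''k'' 0 = k" and f: "\<And>s' e. e < k \<Longrightarrow> s' ''e'' 0 = e \<Longrightarrow>
    \<forall>y. y \<noteq> ''e'' \<and> y \<noteq> ''bT'' \<longrightarrow> s' y = s y \<Longrightarrow> aval f s' = xs ! e"
  shows "wp (For ''e'' (Val ''k'') (Assign ''bT'' (Val ''e'') f))
    (\<lambda>t s'. t \<le> k * (acost f + 20) + 12 \<and> (\<forall>e < k. s' ''bT'' e = xs ! e)) s"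
proof (rule wp_For[where N = k and T = "acost f + 5" and I = "\<lambda>e s'. \<forall>e' < e. s' ''bT'' e' = xs ! e'"], goal_cases)
  case (5 e s')
  then have "aval f s' = xs ! e" by (intro f) auto
  then show ?case using 5 by (intro wp_Assign) (auto simp: update_apply less_Suc_eq)
next
  case (6 t s')
  then show ?case by (auto simp: algebra_simps)
qed (use k in \<open>auto simp: update_apply\<close>)

lemma wp_scan_loop:
  assumes S: "scan_env i A Z s" and init: "\<forall>x < m. s ''ins'' x = 0"
  shows "wp scan_loop (\<lambda>t s'. t \<le> 1000 * (m ^ k * (k * m)) \<and> best_is (search i A Z (m ^ k)) s' \<and>
     (\<forall>x < m. s' ''ins'' x = 0)) s"
proof -
  \<comment> \<open>After \<open>v\<close> tuples the store agrees with the state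
    \<open>search i A Z v\<close>: the program follows \<open>scan\<close> step by step.\<close>
  let ?I = "\<lambda>v s'. best_is (search i A Z v) s' \<and> (\<forall>x < m. s' ''ins'' x = 0)"
  have km: "1 \<le> k * m" "k \<le> k * m" using k_pos m_pos by auto
  have S': "s ''k'' 0 = k" "s ''m'' 0 = m" "s ''p'' 0 = p" using S by (auto simp: scan_env_def env_def)
  show ?thesis unfolding scan_loop_def
  proof (intro wp_Seq wp_Assign, rule wp_frame[OF wp_copy[of _ _ "replicate k p"]], goal_cases)
    case (3 t1 s1)
    then have t1: "t1 \<le> k * 22 + 12" "\<forall>e < k. s1 ''bT'' e = p" "s1 ''fd'' 0 = 0" "s1 ''bc'' 0 = 0"
      and fr1: "\<forall>y. y \<notin> {''e'', ''bT'', ''fd'', ''bc''} \<longrightarrow> s1 y = s y"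
      by (auto simp: update_apply)
    show ?case
    proof (rule wp_Enum[where I = ?I and ll = k and bb = m and T = "600 * (k * m)"], goal_cases)
      case 10
      then show ?case using t1 init fr1 by (simp add: best_is_def search_def)
    next
      case (11 v s2 s3)
      then show ?case by (simp add: best_is_def split: prod.splits)
    next
      case (12 v s2)
      have fr2: "\<forall>y. y \<notin> {''e'', ''bT'', ''fd'', ''bc'', ''T'', ''h2'', ''go2'', ''ok'', ''ins'', ''r'', ''c''} \<longrightarrow> s2 y = s y"
        using 12(4) fr1 by auto
      obtain fd0 c0 T0 where b0: "search i A Z v = (fd0, c0, T0)" by (cases "search i A Z v") auto
      have T: "holds_tuple (tuple v) s2" using 12(3) set_tuple by (auto simp: holds_tuple_def tuple_def)
      have S2: "scan_env i A Z s2" by (rule scan_env_cong[OF S]) (simp add: fr2)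
      show ?case
      proof (rule wp_Seq, rule wp_frame[OF wp_check[OF S2 T]], goal_cases)
        case 1
        then show ?case using 12(2) by simp
      next
        case (2 t3 s3)
        have t3: "t3 \<le> 400 * (k * m)" "s3 ''ok'' 0 = of_bool (admits A Z (tuple v))"
          "s3 ''c'' 0 = cost_of i (tuple v)" "\<forall>x<m. s3 ''ins'' x = 0" using 2(1) by blast+
        have fr3: "\<forall>y. y \<notin> {''e'', ''ok'', ''ins'', ''r'', ''c''} \<longrightarrow> s3 y = s2 y" using 2(2) by auto
        have best3: "s3 ''fd'' 0 = of_bool fd0" "s3 ''bc'' 0 = c0" "\<forall>e < k. s3 ''bT'' e = T0 ! e"
          using 12(2) b0 fr3 by (simp_all add: best_is_def)
        have next_best: "search i A Z (Suc v) = (if admits A Z (tuple v) \<and> (\<not> fd0 \<or> cost_of i (tuple v) < c0)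
          then (True, cost_of i (tuple v), tuple v) else (fd0, c0, T0))"
          using b0 by (simp add: search_def)
        show ?case
        proof (intro wp_Cond wp_Seq wp_Assign wp_Skip, goal_cases)
          case 1
          then have upd: "admits A Z (tuple v) \<and> (\<not> fd0 \<or> cost_of i (tuple v) < c0)"
            using t3 best3 by auto
          show ?case
          proof (rule wp_frame[OF wp_copy[of _ _ "tuple v"]], goal_cases)
            case 1
            then show ?case using S' fr2 fr3 by (simp add: update_apply)
          next
            case (2 s' e)
            then have "s' ''T'' = s3 ''T''" by (simp add: update_apply)
            then show ?case using 2 T fr3 by (simp add: holds_tuple_def)
          next
            case (3 t4 s4)
            then have "s4 ''fd'' 0 = 1" "s4 ''bc'' 0 = cost_of i (tuple v)" "s4 ''ins'' = s3 ''ins''"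
              "t4 \<le> k * 23 + 12" "\<forall>e < k. s4 ''bT'' e = tuple v ! e"
              using t3 by (auto simp: update_apply)
            moreover from this have "t3 + t4 + 40 \<le> 600 * (k * m)" using t3(1) km by linarith
            ultimately show ?case using upd next_best t3 by (simp add: best_is_def)
          qed
        next
          case 2
          then have "\<not> (admits A Z (tuple v) \<and> (\<not> fd0 \<or> cost_of i (tuple v) < c0))"
            using t3 best3 by auto
          then have "search i A Z (Suc v) = (fd0, c0, T0)" using next_best by auto
          moreover have "t3 + 40 \<le> 600 * (k * m)" using t3(1) km by linarith
          ultimately show ?case using t3 best3 by (simp add: best_is_def)
        qed
      qed
    next
      case (13 t2 s2)
      let ?M = "m ^ k"
      have t2: "t2 \<le> ?M * (600 * (k * m) + (2 * k + 4) * 34)" using 13(3) by simp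
      have "600 * (k * m) + (2 * k + 4) * 34 + (k * 22 + 12 + 10) \<le> 1000 * (k * m)"
        using km by (simp only: add_mult_distrib)
      then have "?M * (600 * (k * m) + (2 * k + 4) * 34 + (k * 22 + 12 + 10)) \<le> ?M * (1000 * (k * m))"
        by (rule mult_le_mono2)
      moreover have "k * 22 + 12 + 10 \<le> ?M * (k * 22 + 12 + 10)" using m_pos by simp
      ultimately have "t1 + t2 + 10 \<le> 1000 * (?M * (k * m))" using t1(1) t2
        unfolding distrib_left[of ?M] by linarith
      then show ?case using 13(1) by simp
    qed (use S' fr1 m_pos in auto)
  qed (use S' in \<open>auto simp: update_apply\<close>)
qed

lemma search_best: "best_is (search i A Z (m ^ k)) s \<Longrightarrow> e < k \<Longrightarrow> s ''bT'' e = cheapest i A Z ! e"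
  by (auto simp: best_is_def cheapest_def split: prod.splits)

lemma wp_store_petal:
  assumes S: "env s" and t: "t < petal_count" and tv: "s ''t'' 0 = t"
    and best: "\<forall>e < k. s ''bT'' e = T ! e" and T: "length T = k" "set T \<subseteq> {..<m}"
    and pk: "\<forall>d < t * k. s ''pk'' d = xs ! d" "length xs = t * k"
    and mark: "\<forall>x < m. 0 < s ''mark'' x \<longleftrightarrow> x \<in> Z"
  shows "wp (For ''e'' (Val ''k'')
          (Seq (Assign ''pk'' (Plus (Read ''mk'' (Val ''t'')) (Val ''e'')) (Read ''bT'' (Val ''e'')))
            (Assign ''mark'' (Read ''bT'' (Val ''e'')) (Const 1))))
     (\<lambda>u s'. u \<le> k * 60 + 20 \<and> (\<forall>d < Suc t * k. s' ''pk'' d = (xs @ T) ! d) \<and>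
       (\<forall>x < m. 0 < s' ''mark'' x \<longleftrightarrow> x \<in> Z \<union> set T)) s"
proof (rule wp_For[where N = k and T = 40 and
    I = "\<lambda>e s'. (\<forall>d < t * k + e. s' ''pk'' d = (xs @ T) ! d) \<and>
       (\<forall>x < m. 0 < s' ''mark'' x \<longleftrightarrow> x \<in> Z \<union> set (take e T))"], goal_cases)
  case 3
  then show ?case using pk mark by (simp add: nth_append)
next
  case (5 e s')
  have fr: "s' ''t'' = s ''t''" "s' ''mk'' = s ''mk''" "s' ''bT'' = s ''bT''" using 5(4) by auto
  have mk: "s ''mk'' t = t * k" using S t by (simp add: env_def)
  have Te: "T ! e < m" using T 5(1) nth_mem by fastforce
  have inv: "\<forall>d < t * k + e. s' ''pk'' d = (xs @ T) ! d"
    "\<forall>x < m. 0 < s' ''mark'' x \<longleftrightarrow> x \<in> Z \<union> set (take e T)" using 5(2) by blast+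
  have new: "(xs @ T) ! (t * k + e) = T ! e" using pk(2) by (simp add: nth_append)
  show ?case
    apply (intro wp_Seq wp_Assign)
    using inv new 5(1,3) fr mk best tv T(1) set_take_Suc[of e T]
    by (simp add: update_apply less_Suc_eq)
next
  case (6 u s')
  then show ?case using T(1) by (simp add: add.commute)
qed (use S in \<open>auto simp: update_apply env_def\<close>)

lemma wp_petal_loop:
  assumes S: "env s" "i < n" "s ''i'' 0 = i" "s ''j'' 0 = length A" "length A \<le> k"
      "\<forall>e < length A. s ''A'' e = A ! e" "set A \<subseteq> {..<m}"
    and init: "\<forall>x < m. s ''ins'' x = 0"
  shows "wp petal_loop (\<lambda>t s'. t \<le> 2000 * (petal_count * (m ^ k * (k * m))) \<and>
     (\<forall>d < digits_base. s' ''pk'' d = pick i A d) \<and> (\<forall>x < m. s' ''ins'' x = 0)) s"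
proof -
  let ?M = "m ^ k * (k * m)"
  have M: "1 \<le> ?M" "k \<le> ?M" "m \<le> ?M" using k_pos m_pos by auto
  have C: "1 \<le> petal_count" "?M \<le> petal_count * ?M" by (auto simp: petal_count_def)
  have E: "s ''k'' 0 = k" "s ''m'' 0 = m" "s ''p'' 0 = p" "s ''P'' 0 = petal_count"
    "s ''mk'' petal_count = petal_count * k" using S(1) by (auto simp: env_def)
  show ?thesis unfolding petal_loop_def
  proof (intro wp_Seq, rule wp_For[where N = m and T = 10 and I = "\<lambda>x s'. \<forall>y < x. s' ''mark'' y = 0"], goal_cases)
    case (5 x s')
    then show ?case by (intro wp_Assign) (simp add: update_apply less_Suc_eq)
  next
    case (6 t1 s1)
    have fr1: "\<forall>y. y \<notin> {''x'', ''mark''} \<longrightarrow> s1 y = s y" using 6(3) by simp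
    have t1: "t1 \<le> 30 * m + 20" using 6(4) by simp
    show ?case
    proof (intro wp_Seq, rule wp_For[where N = "length A" and T = 10 and
          I = "\<lambda>e s'. \<forall>x < m. 0 < s' ''mark'' x \<longleftrightarrow> x \<in> set (take e A)"], goal_cases)
      case 3
      then show ?case using 6(1) by simp
    next
      case (5 e s')
      then have "s' ''A'' e = A ! e" using fr1 S(6) by simp
      then show ?case using 5(1-3) set_take_Suc[of e A] by (intro wp_Assign) (simp add: update_apply)
    next
      case (6 t2 s2)
      have fr2: "\<forall>y. y \<notin> {''x'', ''mark'', ''e''} \<longrightarrow> s2 y = s y" using 6(3) fr1 by simp
      have "length A * (10 + acost (Val ''j'') + 10) \<le> k * 30" using S(5) by (intro mult_le_mono) auto
      then have t2: "t2 \<le> k * 30 + 20" using 6(4) by simp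
      have mark2: "\<forall>x < m. 0 < s2 ''mark'' x \<longleftrightarrow> x \<in> set A" using 6(1) by simp
      show ?case
      proof (intro wp_Seq, rule wp_For[where N = petal_count and T = "1200 * ?M" and
          I = "\<lambda>t s'. (\<forall>d < t * k. s' ''pk'' d = petals i A t ! d) \<and> (\<forall>x < m. s' ''ins'' x = 0) \<and>
            (\<forall>x < m. 0 < s' ''mark'' x \<longleftrightarrow> x \<in> set A \<union> set (petals i A t))"], goal_cases)
        case 3
        then show ?case using mark2 init fr2 by simp
      next
        case (5 t s3)
        have fr3: "\<forall>y. y \<notin> {''x'', ''t'', ''pk'', ''mark'', ''fd'', ''bc'', ''bT'', ''T'', ''h2'', ''go2'', ''e'', ''ok'', ''ins'', ''r'', ''c''}
          \<longrightarrow> s3 y = s y" using 5(4) fr2 by simp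
        let ?Z = "set A \<union> set (petals i A t)"
        have env3: "env s3" by (rule env_cong[OF S(1)]) (simp add: fr3)
        have S3: "scan_env i A ?Z s3" using env3 5(2) S(2-6) fr3 unfolding scan_env_def by simp
        show ?case
        proof (rule wp_Seq, rule wp_frame[OF wp_scan_loop[OF S3]], goal_cases)
          case 1
          then show ?case using 5(2) by simp
        next
          case (2 t4 s4)
          have fr4: "\<forall>y. y \<notin> {''fd'', ''bc'', ''bT'', ''T'', ''h2'', ''go2'', ''e'', ''ok'', ''ins'', ''r'', ''c''}
            \<longrightarrow> s4 y = s3 y" using 2(2) by simp
          have t4: "t4 \<le> 1000 * ?M" "\<forall>e < k. s4 ''bT'' e = cheapest i A ?Z ! e" "\<forall>x<m. s4 ''ins'' x = 0"
            using 2(1) search_best by auto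
          show ?case
          proof (rule wp_frame[OF wp_store_petal[of _ t "cheapest i A ?Z" "petals i A t" ?Z]], goal_cases)
            case 1
            then show ?case by (rule env_cong[OF env3]) (simp add: fr4)
          next
            case (10 t5 s5)
            then have "s5 ''ins'' = s4 ''ins''" by simp
            moreover have "t4 + t5 \<le> 1200 * ?M" using 10(1) t4(1) M by linarith
            ultimately show ?case using 10(1) t4 by (simp add: Un_assoc)
          qed (use 5 t4 fr4 search_range in \<open>simp_all add: cheapest_def\<close>)
        qed
      next
        case (6 t3 s3)
        have fr3: "s3 ''mk'' = s ''mk''" "s3 ''P'' = s ''P''" "s3 ''p'' = s ''p''" using 6(3) fr2 by auto
        have t3: "t3 \<le> 1200 * (petal_count * ?M) + 12 * petal_count + 12"
          using 6(4) by (simp add: algebra_simps)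
        have "petal_count \<le> petal_count * ?M" using M by simp
        then have "t1 + (t2 + (t3 + 10)) \<le> 2000 * (petal_count * ?M)"
          using t1 t2 t3 M C by linarith
        then show ?case using 6(1) fr3 E
          by (intro wp_Assign) (auto simp: update_apply pick_def nth_append less_Suc_eq)
      qed (use E fr2 in \<open>auto simp: update_apply\<close>)
    qed (use S fr1 in \<open>auto simp: update_apply\<close>)
  qed (use E in \<open>auto simp: update_apply\<close>)
qed

end

text \<open>When the kernel is complete, \<open>j\<close> has the value \<open>k\<close>, and one
  more call of \<open>scan_loop\<close> tells both whether the kernel is distinct and what it costs.
  With repetitions the scores become meaningless, but then \<open>fail\<close> is set.\<close>

definition vote_loop :: com where
  "vote_loop = Seq (For ''j'' (Val ''k'') (Seq petal_loop
       (Assign ''A'' (Val ''j'') (Read ''pk'' (Read ''g'' (Plus (Read ''mk'' (Val ''i'')) (Val ''j'')))))))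
     (Seq scan_loop
     (Seq (Cond (Less (Const 0) (Val ''fd'')) Skip (Put ''fail'' (Const 1)))
     (Seq (Put ''tot'' (Plus (Val ''tot'') (Val ''bc'')))
       (For ''e'' (Val ''k'') (Assign ''score'' (Read ''A'' (Val ''e''))
          (Plus (Read ''score'' (Read ''A'' (Val ''e''))) (Const 1)))))))"

lemma mods_vote_loop [simp]: "mods vote_loop =
    {''j'', ''A'', ''tot'', ''fail'', ''score''} \<union> mods petal_loop"
  by (auto simp: vote_loop_def)

lemma flip_free_vote_loop [simp]: "flip_free vote_loop"
  by (simp add: vote_loop_def)

text \<open>\<open>out\<close> is 0 at the start and is only ever set to 1, so it accumulates the
  disjunction over all strings.\<close>

definition string_loop :: com where
  "string_loop = Seq (Put ''fail'' (Const 0)) (Seq (Put ''tot'' (Const 0))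
     (Seq (For ''x'' (Val ''m'') (Assign ''score'' (Val ''x'') (Const 0)))
     (Seq (For ''i'' (Val ''n'') vote_loop)
     (Seq (For ''x'' (Val ''m'')
        (Cond (Less (Read ''score'' (Val ''p'')) (Read ''score'' (Val ''x''))) (Put ''fail'' (Const 1)) Skip))
       (Cond (Conj (Less (Val ''fail'') (Const 1)) (Neg (Less (Val ''beta'') (Val ''tot''))))
          (Put ''out'' (Const 1)) Skip)))))"

lemma mods_string_loop [simp]: "mods string_loop = {''i'', ''out''} \<union> mods vote_loop"
  by (auto simp: string_loop_def)

lemma flip_free_string_loop [simp]: "flip_free string_loop"
  by (simp add: string_loop_def)

lemma score_in_0 [simp]: "score_in 0 S c = 0"
  by (simp add: score_in_def)

lemma score_in_Suc: "score_in (Suc i) S c = score_in i S c + of_bool (c \<in> S i)"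
proof -
  have "{j. j < Suc i \<and> c \<in> S j} = {j. j < i \<and> c \<in> S j} \<union> (if c \<in> S i then {i} else {})"
    by (auto simp: less_Suc_eq)
  then show ?thesis by (simp add: score_in_def)
qed

section \<open>Building and scoring the top set of one vote\<close>

context bribery
begin

text \<open>With all \<open>k\<close> positions prescribed, \<open>A\<close> is the only possible
  hit, and it is one exactly if it has no repetition. No position is left for which \<open>Z\<close>
  could matter, so leftover marks do no harm.\<close>

lemma search_full:
  assumes "length A = k" "set A \<subseteq> {..<m}" "search i A Z (m ^ k) = (found, c, T)"
  shows "found = distinct A \<and> (found \<longrightarrow> c = cost_of i A)"
proof -
  have eq: "admits A Z T' \<longleftrightarrow> T' = A \<and> distinct A" if "length T' = k" for T'
  proof
    assume adm: "admits A Z T'"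
    then have "T' = A" using that assms(1) by (intro nth_equalityI) (simp_all add: admits_def)
    then show "T' = A \<and> distinct A" using adm by (simp add: admits_def)
  qed (use assms(1) in \<open>simp add: admits_def\<close>)
  obtain v where v: "v < m ^ k" "tuple v = A" using tuple_surj assms by blast
  show ?thesis
  proof (cases found)
    case True
    then have "admits A Z T" "c = cost_of i T" "\<exists>v < m ^ k. T = tuple v"
      using assms(3) scan_correct[where x = tuple and P = "admits A Z" and f = "cost_of i" and d = "replicate k p" and N = "m ^ k"]
      by (auto simp: search_def)
    moreover from this have "length T = k" by auto
    ultimately show ?thesis using eq[of T] True by blast
  next
    case False
    then have "\<not> admits A Z (tuple v)"
      using v assms(3) scan_correct[where x = tuple and P = "admits A Z" and f = "cost_of i" and d = "replicate k p" and N = "m ^ k"]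
      by (auto simp: search_def)
    then show ?thesis using False v eq[of A] assms(1) by simp
  qed
qed

lemma index_less: "i < n \<Longrightarrow> j < k \<Longrightarrow> i * k + j < n * k"
proof -
  assume "i < n" "j < k"
  then have "i * k + j < Suc i * k" "Suc i * k \<le> n * k" using mult_le_mono1[of "Suc i" n k] by simp_all
  then show ?thesis by (rule less_le_trans)
qed

lemma le_petal_count: "i < n \<Longrightarrow> i \<le> petal_count"
proof -
  assume "i < n"
  then have "i \<le> n - 1" by simp
  also have "\<dots> \<le> (n - 1) * k" using k_pos by simp
  finally show ?thesis by (simp add: petal_count_def)
qed

lemma wp_count:
  assumes k: "s ''k'' 0 = k" and A: "\<forall>e < k. s ''A'' e = A ! e" "length A = k" "distinct A"
  shows "wp (For ''e'' (Val ''k'') (Assign ''score'' (Read ''A'' (Val ''e''))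
          (Plus (Read ''score'' (Read ''A'' (Val ''e''))) (Const 1))))
    (\<lambda>t s'. t \<le> k * 30 + 20 \<and> (\<forall>c. s' ''score'' c = s ''score'' c + of_bool (c \<in> set A))) s"
proof (rule wp_For[where N = k and T = 12 and
    I = "\<lambda>e s'. \<forall>c. s' ''score'' c = s ''score'' c + of_bool (c \<in> set (take e A))"], goal_cases)
  case (5 e s')
  then have "s' ''A'' e = A ! e" using A by simp
  moreover have "A ! e \<notin> set (take e A)"
    using A 5(1) distinct_take[of A "Suc e"] by (simp add: take_Suc_conv_app_nth)
  ultimately show ?case using 5(1-3) A(2) set_take_Suc[of e A]
    by (intro wp_Assign) (simp add: update_apply)
next
  case (6 t s')
  then show ?case using A by simp
qed (use k in \<open>auto simp: update_apply\<close>)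

text \<open>Covers a kernel with repetitions: the string has failed already, and only the time of
  the scoring counts.\<close>

lemma wp_count_any:
  assumes k: "s ''k'' 0 = k"
  shows "wp (For ''e'' (Val ''k'') (Assign ''score'' (Read ''A'' (Val ''e''))
          (Plus (Read ''score'' (Read ''A'' (Val ''e''))) (Const 1))))
    (\<lambda>t s'. t \<le> k * 30 + 20) s"
proof (rule wp_For[where N = k and T = 12 and I = "\<lambda>e s'. True"], goal_cases)
  case (5 e s')
  show ?case by (rule wp_Assign) simp
qed (use k in simp_all)

lemma wp_vote_loop:
  assumes E: "env s" and i: "i < n" "s ''i'' 0 = i" and ins: "\<forall>x < m. s ''ins'' x = 0"
    and g: "\<forall>e < n * k. s ''g'' e = dg e \<and> dg e < digits_base"
  shows "wp vote_loop (\<lambda>t s'. t \<le> 4000 * (k * (petal_count * (m ^ k * (k * m)))) \<and>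
     (\<forall>x < m. s' ''ins'' x = 0) \<and>
     (if distinct (top_of dg i)
      then s' ''fail'' 0 = s ''fail'' 0 \<and> s' ''tot'' 0 = s ''tot'' 0 + cost_of i (top_of dg i) \<and>
        (\<forall>c < m. s' ''score'' c = s ''score'' c + of_bool (c \<in> set (top_of dg i)))
      else s' ''fail'' 0 = 1)) s"
proof -
  let ?M = "petal_count * (m ^ k * (k * m))"
  define A where "A j = grow i [] (map (\<lambda>j. dg (i * k + j)) [0..<j])" for j
  have "1 \<le> petal_count" by (simp add: petal_count_def)
  from mult_le_mono1[OF this, of "m ^ k * (k * m)"] have M2: "m ^ k * (k * m) \<le> ?M" by simp
  moreover have "1 \<le> m ^ k * (k * m)" using k_pos m_pos by simp
  ultimately have M: "1 \<le> ?M" "m ^ k * (k * m) \<le> ?M" by linarith+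
  have kM: "k \<le> k * ?M" "?M \<le> k * ?M" "1 \<le> k * ?M" using M(1) k_pos by auto
  have sA: "set (A j) \<subseteq> {..<m}" if "j \<le> k" for j
    using that g index_less[OF i(1)] unfolding A_def by (intro set_grow) auto
  have A_Suc: "A (Suc j) = A j @ [pick i (A j) (dg (i * k + j))]" for j by (simp add: A_def grow_def)
  have lA [simp]: "length (A j) = j" for j by (simp add: A_def)
  have Ak: "A k = top_of dg i" by (simp add: A_def top_of_def)
  show ?thesis unfolding vote_loop_def
  proof (intro wp_Seq, rule wp_For[where N = k and T = "2000 * ?M + 20" and
      I = "\<lambda>j s'. (\<forall>e < j. s' ''A'' e = A j ! e) \<and> (\<forall>x < m. s' ''ins'' x = 0)"], goal_cases)
    case (5 j s1)
    have fr1: "s1 y = s y" if "y \<notin> {''j'', ''A''} \<union> mods petal_loop" for y using 5(4) that by simp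
    have env1: "env s1" by (rule env_cong[OF E]) (simp add: fr1)
    show ?case
    proof (rule wp_Seq, rule wp_frame[OF wp_petal_loop[of s1 i "A j"]], goal_cases)
      case 1
      show ?case by (rule env1)
    next
      case (9 t2 s2)
      have fr2: "s2 y = s1 y" if "y \<notin> mods petal_loop" for y using 9(2) that by blast
      have "s2 ''g'' (i * k + j) = dg (i * k + j)" "dg (i * k + j) < digits_base"
        using g index_less[OF i(1) 5(1)] fr1 fr2 by simp_all
      then have "s2 ''pk'' (s2 ''g'' (i * k + j)) = pick i (A j) (dg (i * k + j))" using 9(1) by metis
      moreover have "s2 ''mk'' i = i * k" using env1 le_petal_count[OF i(1)] fr2 by (simp add: env_def)
      moreover have "s2 ''j'' 0 = j" "s2 ''i'' 0 = i" "s2 ''A'' = s1 ''A''" using 5(3) i(2) fr1 fr2 by simp_all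
      ultimately show ?case using 9(1) 5(2)
        by (intro wp_Assign) (simp add: update_apply A_Suc nth_append less_Suc_eq)
    qed (use i 5 fr1 sA[of j] in auto)
  next
    case (6 t1 s1)
    have fr1: "s1 y = s y" if "y \<notin> {''j'', ''A''} \<union> mods petal_loop" for y using 6(3) that by simp
    have "t1 \<le> 2000 * (k * ?M) + 32 * k + 12" using 6(4) by (simp add: algebra_simps)
    then have t1: "t1 \<le> 2044 * (k * ?M)" using kM by linarith
    have env1: "env s1" by (rule env_cong[OF E]) (simp add: fr1)
    \<comment> \<open>Whatever marks are left from the growth of the kernel.\<close>
    let ?Z = "{x. 0 < s1 ''mark'' x}"
    have S1: "scan_env i (A k) ?Z s1" using env1 i 6 fr1 unfolding scan_env_def by simp
    obtain fd c T where b: "search i (A k) ?Z (m ^ k) = (fd, c, T)"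
      by (cases "search i (A k) ?Z (m ^ k)") auto
    have full: "fd = distinct (A k) \<and> (fd \<longrightarrow> c = cost_of i (A k))"
      by (rule search_full[OF _ sA b]) simp_all
    show ?case
    proof (rule wp_Seq, rule wp_frame[OF wp_scan_loop[OF S1]], goal_cases)
      case 1
      show ?case using 6(1) by blast
    next
      case (2 t2 s2)
      have fr2: "s2 y = s1 y" if "y \<notin> mods scan_loop" for y using 2(2) that by blast
      have t2: "t2 \<le> 1000 * (k * ?M)" using 2(1) M(2) kM(2) by linarith
      have b2: "s2 ''fd'' 0 = of_bool fd" "s2 ''bc'' 0 = c" using 2(1) b by (simp_all add: best_is_def)
      have k2: "s2 ''k'' 0 = k" using env1 fr2 by (simp add: env_def)
      have old: "s2 ''fail'' = s ''fail''" "s2 ''tot'' = s ''tot''" "s2 ''score'' = s ''score''"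
        using fr1 fr2 by simp_all
      have ins2: "\<forall>x < m. s2 ''ins'' x = 0" using 2(1) by blast
      show ?case
      proof (cases "distinct (A k)")
        case True
        show ?thesis
        proof (intro wp_Seq wp_Cond wp_Skip wp_Assign, goal_cases)
          case 1
          show ?case
          proof (rule wp_frame[OF wp_count[of _ "A k"]], goal_cases)
            case (5 t3 s3)
            have "t1 + t2 + (t3 + 20) \<le> 4000 * (k * ?M)" using t1 t2 5(1) kM by linarith
            then show ?case using 5 True full b2 old ins2 by (simp add: update_apply Ak)
          qed (use 6(1) fr2 k2 True in \<open>simp_all add: update_apply\<close>)
        next
          case 2
          then show ?case using True full b2 by simp
        qed
      next
        case False
        show ?thesis
        proof (intro wp_Seq wp_Cond wp_Skip wp_Assign, goal_cases)
          case 1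
          then show ?case using False full b2 by simp
        next
          case 2
          show ?case
          proof (rule wp_frame[OF wp_count_any], goal_cases)
            case (2 t3 s3)
            have "t1 + t2 + (t3 + 20) \<le> 4000 * (k * ?M)" using t1 t2 2(1) kM by linarith
            then show ?case using 2 False ins2 by (simp add: update_apply Ak)
          qed (use k2 in \<open>simp add: update_apply\<close>)
        qed
      qed
    qed
  qed (use E ins in \<open>simp_all add: update_apply env_def\<close>)
qed

end

definition table :: "string \<Rightarrow> string \<Rightarrow> string \<Rightarrow> com" where
  "table arr l d = For ''x'' (Val l)
     (Assign arr (Plus (Val ''x'') (Const 1)) (Plus (Read arr (Val ''x'')) (Val d)))"

lemma mods_table [simp]: "mods (table arr l d) = {''x'', arr}"
  by (auto simp: table_def)

lemma flip_free_table [simp]: "flip_free (table arr l d)"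
  by (simp add: table_def)

lemma wp_table:
  assumes d: "arr \<noteq> ''x''" "l \<noteq> ''x''" "d \<noteq> ''x''" "l \<noteq> arr" "d \<noteq> arr" and z: "s arr 0 = 0"
  shows "wp (table arr l d) (\<lambda>t s'. t \<le> s l 0 * 30 + 20 \<and> (\<forall>y \<le> s l 0. s' arr y = y * s d 0)) s"
  unfolding table_def
proof (rule wp_For[where N = "s l 0" and T = 12 and I = "\<lambda>x s'. \<forall>y \<le> x. s' arr y = y * s d 0"], goal_cases)
  case (5 x s')
  have "s' d = s d" using 5(4) d by simp
  then show ?case using 5(1-3) d by (intro wp_Assign) (simp add: update_apply le_Suc_eq)
next
  case (6 t s')
  then show ?case by simp
qed (use d z in \<open>simp_all add: update_apply\<close>)

text \<open>The table \<open>mm\<close> is built twice: a first pass up to \<open>n\<close> yields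
  \<open>n * m\<close>, for which \<open>L\<close> is borrowed as a scratch cell, and this is the
  length of the second pass. Likewise \<open>mk\<close> up to \<open>n\<close> yields
  \<open>n * k\<close>, from which \<open>P\<close> follows by one subtraction.\<close>

definition program :: com where
  "program = Cond (Less (Val ''k'') (Val ''m''))
     (Seq (table ''mm'' ''n'' ''m'') (Seq (Put ''L'' (Read ''mm'' (Val ''n'')))
     (Seq (table ''mm'' ''L'' ''m'')
     (Seq (table ''mk'' ''n'' ''k'') (Seq (Put ''L'' (Read ''mk'' (Val ''n'')))
     (Seq (Put ''P'' (Plus (Minus (Val ''L'') (Val ''k'')) (Const 1)))
     (Seq (table ''mk'' ''P'' ''k'')
     (Seq (Put ''B'' (Plus (Read ''mk'' (Val ''P'')) (Const 1)))
       (Enum ''g'' ''h1'' ''go1'' (Val ''L'') (Val ''B'') string_loop)))))))))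
     (Put ''out'' (Const 1))"

lemma flip_free_program: "flip_free program"
  by (simp add: program_def)

section \<open>One string of choices, and the whole program\<close>

context bribery
begin

lemma wp_string_loop:
  assumes E: "env s" and ins: "\<forall>x < m. s ''ins'' x = 0"
    and g: "\<forall>e < n * k. s ''g'' e = dg e \<and> dg e < digits_base"
  shows "wp string_loop (\<lambda>t s'. t \<le> 6000 * (n * (k * (petal_count * (m ^ k * (k * m))))) \<and>
     (\<forall>x < m. s' ''ins'' x = 0) \<and> s' ''out'' 0 = (if success dg then 1 else s ''out'' 0)) s"
proof -
  let ?M = "k * (petal_count * (m ^ k * (k * m)))"
  have "1 \<le> k * petal_count * (m ^ k * k)" using k_pos m_pos by (simp add: petal_count_def)
  from mult_le_mono1[OF this, of m] have mM: "m \<le> ?M" by (simp add: ac_simps)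
  have M: "1 \<le> ?M" using mM m_pos by linarith
  have nM: "n \<le> n * ?M" "?M \<le> n * ?M" "1 \<le> n * ?M" using M n_pos by auto
  define A where "A = top_of dg"
  define S where "S = (\<lambda>i. set (A i))"
  have E': "s ''m'' 0 = m" "s ''n'' 0 = n" "s ''p'' 0 = p" "s ''beta'' 0 = budget I"
    using E by (simp_all add: env_def)
  show ?thesis unfolding string_loop_def
  proof (intro wp_Seq wp_Assign, rule wp_For[where N = m and T = 10 and
      I = "\<lambda>x s'. \<forall>c < x. s' ''score'' c = 0"], goal_cases)
    case (5 x s1)
    then show ?case by (intro wp_Assign) (simp add: update_apply less_Suc_eq)
  next
    case (6 t1 s1)
    have fr1: "s1 y = s y" if "y \<notin> {''x'', ''score'', ''tot'', ''fail''}" for y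
      using 6(3) that by (simp add: update_apply)
    have z1: "s1 ''tot'' 0 = 0" "s1 ''fail'' 0 = 0" "\<forall>c < m. s1 ''score'' c = 0"
      using 6(1,3) by (simp_all add: update_apply)
    have t1: "t1 \<le> 30 * m + 20" using 6(4) by simp
    \<comment> \<open>Totals and scores are tracked only while all kernels so far are distinct;
      afterwards \<open>fail\<close> decides.\<close>
    let ?J = "\<lambda>i s'. (\<forall>x < m. s' ''ins'' x = 0) \<and> s' ''fail'' 0 = of_bool (\<exists>i' < i. \<not> distinct (A i')) \<and>
      ((\<forall>i' < i. distinct (A i')) \<longrightarrow> s' ''tot'' 0 = (\<Sum>i'<i. cost_of i' (A i')) \<and>
        (\<forall>c < m. s' ''score'' c = score_in i S c))"
    show ?case
    proof (intro wp_Seq, rule wp_For[where N = n and T = "4000 * ?M" and I = ?J], goal_cases)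
      case 3
      then show ?case using ins z1 fr1 by simp
    next
      case (5 i s2)
      have fr2: "s2 y = s y" if "y \<notin> {''i'', ''x'', ''score'', ''tot'', ''fail''} \<union> mods vote_loop" for y
        using 5(4) that fr1[of y] by simp
      have env2: "env s2" by (rule env_cong[OF E]) (simp add: fr2)
      show ?case
      proof (rule wp_mono[OF wp_vote_loop[OF env2 5(1,3), of dg]], goal_cases)
        case 1
        then show ?case using 5(2) by blast
      next
        case 2
        then show ?case using g fr2[of "''g''"] by simp
      next
        case (3 t3 s3)
        show ?case
        proof (cases "distinct (A i)")
          case True
          then show ?thesis using 3 5(2) by (auto simp: A_def S_def score_in_Suc less_Suc_eq)
        next
          case False
          then show ?thesis using 3 by (auto simp: A_def)
        qed
      qed
    next
      case (6 t2 s2)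
      have fr2: "s2 y = s y" if "y \<notin> {''i'', ''x'', ''score'', ''tot'', ''fail''} \<union> mods vote_loop" for y
        using 6(3) that fr1[of y] by simp
      have t2: "t2 \<le> 4000 * (n * ?M) + 12 * n + 12" using 6(4) by (simp add: algebra_simps)
      show ?case
      proof (intro wp_Seq, rule wp_For[where N = m and T = 30 and I = "\<lambda>x s'. s' ''fail'' 0 =
          of_bool ((\<exists>i' < n. \<not> distinct (A i')) \<or> (\<exists>c < x. s2 ''score'' p < s2 ''score'' c))"], goal_cases)
        case 3
        then show ?case using 6(1) by simp
      next
        case (5 x s3)
        have fr3: "s3 ''score'' = s2 ''score''" "s3 ''p'' = s ''p''" using 5(4) fr2[of "''p''"] by simp_all
        show ?case
          by (intro wp_Cond wp_Skip wp_Assign) (use 5(2,3) fr3 E' in \<open>auto simp: update_apply less_Suc_eq\<close>)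
      next
        case (6 t3 s3)
        have fr3: "s3 ''tot'' = s2 ''tot''" "s3 ''ins'' = s2 ''ins''" "s3 ''beta'' = s ''beta''" "s3 ''out'' = s ''out''"
          using 6(3) fr2[of "''beta''"] fr2[of "''out''"] by simp_all
        have "t3 \<le> 50 * m + 20" using 6(4) by simp
        then have t: "t1 + (t2 + (t3 + 60)) \<le> 6000 * (n * ?M)" using t1 t2 mM nM by linarith
        note J = \<open>?J n s2\<close>
        have suc: "success dg \<longleftrightarrow> (s3 ''fail'' 0 < 1 \<and> \<not> budget I < s3 ''tot'' 0)"
        proof (cases "\<forall>i' < n. distinct (A i')")
          case True
          then have "s2 ''tot'' 0 = (\<Sum>i'<n. cost_of i' (A i'))" "\<forall>c < m. s2 ''score'' c = score_in n S c"
            using J by blast+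
          then have "s3 ''tot'' 0 = (\<Sum>i'<n. cost_of i' (A i'))"
            "s3 ''fail'' 0 = of_bool (\<exists>c < m. score_in n S p < score_in n S c)"
            using 6(1) True p_less fr3 by auto
          moreover have "success dg \<longleftrightarrow> (\<Sum>i'<n. cost_of i' (A i')) \<le> budget I \<and>
              \<not> (\<exists>c < m. score_in n S p < score_in n S c)"
            using True unfolding success_def A_def S_def by (meson not_less)
          ultimately show ?thesis by (simp add: not_less conj_commute)
        next
          case False
          then show ?thesis using 6(1) by (auto simp: success_def A_def)
        qed
        have ins3: "\<forall>x < m. s3 ''ins'' x = 0" using J fr3 by simp
        show ?case
        proof (intro wp_Cond wp_Skip wp_Assign, goal_cases)
          case 1
          then have "success dg" using suc fr3 E' by simp
          then show ?case using t ins3 by (simp add: update_apply)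
        next
          case 2
          then have "\<not> success dg" using suc fr3 E' by simp
          then show ?case using t ins3 fr3 by simp
        qed
      qed (use E' fr2 in \<open>simp_all add: update_apply\<close>)
    qed (use E' fr1 in \<open>simp_all add: update_apply\<close>)
  qed (use E' in \<open>simp_all add: update_apply\<close>)
qed

lemma input_store_env:
  assumes "s = input_store k I"
  shows "s ''n'' 0 = n" "s ''m'' 0 = m" "s ''k'' 0 = k" "s ''p'' 0 = p"
    "s ''beta'' 0 = budget I" "s ''mm'' 0 = 0" "s ''mk'' 0 = 0" "s ''out'' 0 = 0"
    "s ''ins'' x = 0"
    "\<And>i r. i < n \<Longrightarrow> r < m \<Longrightarrow> s ''vote'' (i * m + r) = votes I ! i ! r"
    "\<And>i a b. i < n \<Longrightarrow> a < m \<Longrightarrow> b < m \<Longrightarrow> s ''cost'' (i * m * m + a * m + b) = swap_cost I i a b"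
proof -
  show "s ''vote'' (i * m + r) = votes I ! i ! r" if "i < n" "r < m" for i r
  proof -
    have "i * m + r < Suc i * m" "Suc i * m \<le> n * m"
      using that mult_le_mono1[of "Suc i" n m] by simp_all
    then have "i * m + r < n * m" by (rule less_le_trans)
    then show ?thesis using that assms by (simp add: input_store_def Let_def)
  qed
  show "s ''cost'' (i * m * m + a * m + b) = swap_cost I i a b" if "i < n" "a < m" "b < m" for i a b
  proof -
    have ab: "a * m + b < m * m"
    proof -
      have "a * m + b < Suc a * m" "Suc a * m \<le> m * m"
        using that mult_le_mono1[of "Suc a" m m] by simp_all
      then show ?thesis by (rule less_le_trans)
    qed
    define j where "j = i * m * m + a * m + b"
    \<comment> \<open>Two bracketings of the address: the first splits off \<open>i\<close> on
      division by \<open>m * m\<close>, the second splits off \<open>b\<close> on division by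
      \<open>m\<close>.\<close>
    have j1: "j = i * (m * m) + (a * m + b)" and j2: "j = (i * m + a) * m + b"
      by (simp_all add: j_def algebra_simps)
    have "j < Suc i * (m * m)" using ab j1 by simp
    also have "\<dots> \<le> n * (m * m)" using that by (intro mult_le_mono1) simp
    finally have "j < n * m * m" by (simp add: mult.assoc)
    moreover have "j div (m * m) = i" using ab m_pos unfolding j1 by simp
    moreover have "j div m = i * m + a" "j mod m = b" using that unfolding j2 by simp_all
    moreover from this have "j div m mod m = a" using that by simp
    ultimately show ?thesis using assms unfolding j_def[symmetric]
      by (simp add: input_store_def Let_def)
  qed
qed (simp_all add: assms input_store_def scalar_def Let_def)

lemma petal_count_eq: "petal_count = n * k - k + 1"
  by (simp add: petal_count_def diff_mult_distrib)

lemma petal_count_le: "petal_count \<le> n * k"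
proof -
  have "k \<le> n * k" using n_pos by simp
  then show ?thesis using k_pos unfolding petal_count_eq by linarith
qed

lemma wp_program:
  "wp program (\<lambda>t s'. t \<le> 8000 * (digits_base ^ (n * k) * (n * (k * (petal_count * (m ^ k * (k * m))))))
     \<and> s' ''out'' 0 = of_bool (approval_swap_bribery k I)) (input_store k I)"
proof -
  define s where "s = input_store k I"
  note inp = input_store_env[OF s_def]
  let ?M = "n * (k * (petal_count * (m ^ k * (k * m))))"
  have pos: "0 < n" "0 < m" "0 < k" "0 < petal_count" using n_pos m_pos k_pos by (auto simp: petal_count_def)
  have nm: "m \<le> n * m" "n \<le> n * m" and nk: "k \<le> n * k" using pos by auto
  have "1 \<le> k * (petal_count * (m ^ k * k))" using pos by simp
  from mult_le_mono1[OF this, of "n * m"] have M1: "n * m \<le> ?M" by (simp add: ac_simps)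
  have "1 \<le> petal_count * (m ^ k * (k * m))" using pos by simp
  from mult_le_mono1[OF this, of "n * k"] have M2: "n * k \<le> ?M" by (simp add: ac_simps)
  show ?thesis unfolding s_def[symmetric] program_def
  proof (intro wp_Cond wp_Assign, goal_cases)
    case 1
    show ?case
    proof (intro wp_Seq, rule wp_frame[OF wp_table], goal_cases)
      case (7 t1 s1)
      have fr1: "s1 y = s y" if "y \<notin> {''x'', ''mm''}" for y using 7(2) that by simp
      have t1: "t1 \<le> n * 30 + 20" and mm1: "\<forall>y \<le> n. s1 ''mm'' y = y * m" using 7(1) inp by simp_all
      show ?case
      proof (intro wp_Seq wp_Assign, rule wp_frame[OF wp_table], goal_cases)
        case 6
        show ?case using mm1 by (simp add: update_apply)
      next
        case (7 t2 s2)
        have L1: "s1 ''mm'' (s1 ''n'' 0) = n * m" using mm1 fr1 inp by simp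
        have fr2: "s2 y = s y" if "y \<notin> {''x'', ''mm'', ''L''}" for y
          using 7(2) that fr1 by (simp add: update_apply)
        have t2: "t2 \<le> n * m * 30 + 20" and mm2: "\<forall>y \<le> n * m. s2 ''mm'' y = y * m"
          using 7(1) L1 fr1 inp by (simp_all add: update_apply)
        show ?case
        proof (intro wp_Seq, rule wp_frame[OF wp_table], goal_cases)
          case 6
          show ?case using fr2 inp by simp
        next
          case (7 t3 s3)
          have fr3: "s3 y = s2 y" if "y \<notin> {''x'', ''mk''}" for y using 7(2) that by simp
          have t3: "t3 \<le> n * 30 + 20" and mk3: "\<forall>y \<le> n. s3 ''mk'' y = y * k"
            using 7(1) fr2 inp by simp_all
          have L3: "s3 ''mk'' (s3 ''n'' 0) = n * k" and k3: "s3 ''k'' 0 = k" using mk3 fr2 fr3 inp by simp_all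
          show ?case
          proof (intro wp_Seq wp_Assign, rule wp_frame[OF wp_table], goal_cases)
            case 6
            show ?case using mk3 by (simp add: update_apply)
          next
            case (7 t4 s4)
            have fr4: "s4 y = s2 y" if "y \<notin> {''x'', ''mk'', ''L'', ''P''}" for y
              using 7(2) fr3 that by (simp add: update_apply)
            have P4: "s4 ''P'' 0 = petal_count" and L4: "s4 ''L'' 0 = n * k"
              using 7(2) L3 k3 by (simp_all add: update_apply petal_count_eq)
            have t4: "t4 \<le> petal_count * 30 + 20" and mk4: "\<forall>y \<le> petal_count. s4 ''mk'' y = y * k"
              using 7(1) L3 k3 by (simp_all add: update_apply petal_count_eq)
            let ?I = "\<lambda>v s'. env s' \<and> (\<forall>x < m. s' ''ins'' x = 0) \<and>
               s' ''out'' 0 = of_bool (\<exists>v' < v. success (digit digits_base v'))"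
            let ?s5 = "update s4 ''B'' 0 (petal_count * k + 1)"
            have env5: "env ?s5" unfolding env_def
              using P4 L4 mk4 mm2 fr4 fr2 inp by (simp add: update_apply)
            have s5: "update s4 ''B'' (aval (Const 0) s4) (aval (Plus (Read ''mk'' (Val ''P'')) (Const 1)) s4) = ?s5"
              using P4 mk4 by simp
            show ?case unfolding s5
            proof (intro wp_Seq wp_Assign, unfold s5, rule wp_Enum[where I = ?I and ll = "n * k" and bb = digits_base
                  and T = "6000 * ?M"], goal_cases)
              case 10
              show ?case using env5 fr4 fr2 inp by (simp add: update_apply)
            next
              case (11 v s5 s6)
              then have "env s6" using env_cong[of s5 s6] by simp
              then show ?case using 11 by simp
            next
              case (12 v s5)
              show ?case
              proof (rule wp_frame[OF wp_string_loop[of s5 "digit digits_base v"]], goal_cases)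
                case 3
                then show ?case using 12(3) digit_less[of digits_base v] by simp
              next
                case (4 t6 s6)
                have "env s5" using 12(2) by blast
                then have "env s6" by (rule env_cong) (use 4(2) in simp)
                moreover have "(\<exists>v' < Suc v. success (digit digits_base v')) \<longleftrightarrow>
                    (\<exists>v' < v. success (digit digits_base v')) \<or> success (digit digits_base v)"
                  by (auto simp: less_Suc_eq)
                moreover have "s5 ''out'' 0 = of_bool (\<exists>v' < v. success (digit digits_base v'))"
                  using 12(2) by blast
                ultimately show ?case using 4(1) by simp
              qed (use 12 in simp_all)
            next
              case (13 t5 s5)
              let ?W = "digits_base ^ (n * k)"
              have W: "?M \<le> ?W * ?M" by simp
              have "t5 \<le> ?W * (6000 * ?M + (2 * (n * k) + 4) * 34)" using 13(3) by simp
              also have "\<dots> \<le> ?W * (6300 * ?M)"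
              proof (rule mult_le_mono2)
                have "6000 * y + (2 * x + 4) * 34 \<le> 6300 * y" if "1 \<le> x" "x \<le> y" for x y :: nat
                  using that by simp
                moreover have "1 \<le> n * k" using pos by simp
                ultimately show "6000 * ?M + (2 * (n * k) + 4) * 34 \<le> 6300 * ?M" using M2 by blast
              qed
              also have "\<dots> = 6300 * (?W * ?M)" by (simp only: ac_simps)
              finally have t5: "t5 \<le> 6300 * (?W * ?M)" .
              have "1 \<le> n * m" using pos by simp
              then have tot: "t1 + (t2 + (t3 + (t4 + (t5 + 100)))) \<le> 8000 * (?W * ?M)"
                using t1 t2 t3 t4 t5 W M1 M2 nm petal_count_le by linarith
              have "s5 ''out'' 0 = of_bool (approval_swap_bribery k I)"
                using 13(1) bribery_iff_success by simp
              then show ?case using tot by simp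
            qed (use env5 in \<open>simp_all add: env_def\<close>)
          qed simp_all
        qed simp_all
      qed simp_all
    qed (use inp in simp_all)
  next
    case 2
    then show ?case using k_less inp by simp
  qed
qed

end

section \<open>The time bound\<close>

text \<open>Bernoulli's inequality gives \<open>N \<le> 10 * 1.1 ^ N\<close>. The rate 1.1 is chosen
  so that its cube times 3/4, which is 0.99825, stays below 1.\<close>

lemma cube_times_power_le: "real N ^ 3 * (3 / 4) ^ N \<le> 1000"
proof -
  have "real N \<le> 10 * (1 + real N * (1 / 10))" by simp
  also have "\<dots> \<le> 10 * (11 / 10) ^ N"
    using Bernoulli_inequality[of "1 / 10 :: real" N] by simp
  finally have "real N ^ 3 \<le> (10 * (11 / 10) ^ N) ^ 3" by (rule power_mono) simp
  also have "\<dots> = 1000 * (1331 / 1000) ^ N"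
  proof -
    have "(10 * (11 / 10 :: real) ^ N) ^ 3 = 10 ^ 3 * ((11 / 10) ^ 3) ^ N"
      by (simp only: power_mult_distrib power_mult[symmetric] mult.commute)
    then show ?thesis by (simp add: power3_eq_cube)
  qed
  finally have "real N ^ 3 * (3 / 4) ^ N \<le> 1000 * (1331 / 1000) ^ N * (3 / 4) ^ N"
    by (rule mult_right_mono) simp
  also have "\<dots> = 1000 * (3993 / 4000) ^ N" by (simp flip: power_mult_distrib)
  also have "\<dots> \<le> 1000" by (simp add: power_le_one)
  finally show ?thesis .
qed

context bribery
begin

text \<open>At \<open>n * k = 1\<close> the base is 2 and the inequality fails. At
  \<open>n * k = 2\<close> both sides are 12, so the ratio 3/4 cannot be lowered.\<close>

lemma digits_base_le:
  assumes "2 \<le> n * k"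
  shows "4 * digits_base \<le> 3 * (n * k) ^ 2"
proof -
  obtain a where a: "n = Suc a" using n_pos gr0_conv_Suc by auto
  have B: "4 * digits_base = 4 * (a * (k * k)) + 4 * k + 4"
    by (simp add: petal_count_def a algebra_simps)
  have S: "3 * (n * k) ^ 2 = 3 * (a * a * (k * k)) + 6 * (a * (k * k)) + 3 * (k * k)"
    unfolding a by (simp add: power2_eq_square algebra_simps)
  have kk: "k \<le> k * k" using k_pos by simp
  show ?thesis
  proof (cases "a = 0")
    case True
    then have "2 \<le> k" using assms a by simp
    then have "2 * k \<le> k * k" by simp
    with \<open>2 \<le> k\<close> have "4 * k + 4 \<le> 3 * (k * k)" by linarith
    then show ?thesis unfolding B S using True by simp
  next
    case False
    then have "k * k \<le> a * (k * k)" "a * (k * k) \<le> a * a * (k * k)" by simp_all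
    then show ?thesis unfolding B S using kk k_pos by linarith
  qed
qed

text \<open>The factor \<open>(n * k) ^ 3\<close> must disappear without a constant that grows with
  \<open>k\<close>: the power of 3/4 saved by \<open>digits_base_le\<close> pays for it. The
  constant is 8000 from the program times 1000 from \<open>cube_times_power_le\<close>.\<close>

lemma time_bound:
  "real (8000 * (digits_base ^ (n * k) * (n * (k * (petal_count * (m ^ k * (k * m)))))))
     \<le> 8000000 * real (n * k) ^ (2 * (n * k)) * real m ^ (k + 1)"
proof -
  let ?N = "n * k"
  have N: "1 \<le> ?N" "k \<le> ?N" using n_pos k_pos by auto
  have base: "real ?N ^ 3 * real digits_base ^ ?N \<le> 1000 * real ?N ^ (2 * ?N)"
  proof (cases "2 \<le> ?N")
    case True
    have "real (4 * digits_base) \<le> real (3 * ?N ^ 2)"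
      using digits_base_le[OF True] of_nat_le_iff by blast
    then have "real digits_base \<le> 3 / 4 * real ?N ^ 2" by simp
    then have "real digits_base ^ ?N \<le> (3 / 4 * real ?N ^ 2) ^ ?N" by (intro power_mono) simp_all
    also have "\<dots> = (3 / 4) ^ ?N * real ?N ^ (2 * ?N)" by (simp only: power_mult_distrib power_mult)
    finally have "real ?N ^ 3 * real digits_base ^ ?N \<le> real ?N ^ 3 * ((3 / 4) ^ ?N * real ?N ^ (2 * ?N))"
      by (intro mult_left_mono) simp_all
    also have "\<dots> = (real ?N ^ 3 * (3 / 4) ^ ?N) * real ?N ^ (2 * ?N)" by (simp only: mult.assoc)
    also have "\<dots> \<le> 1000 * real ?N ^ (2 * ?N)"
      by (intro mult_right_mono cube_times_power_le) simp
    finally show ?thesis .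
  next
    \<comment> \<open>Only \<open>n * k = 1\<close> is left, where direct evaluation replaces
      \<open>digits_base_le\<close>.\<close>
    case False
    then have "n * k = 1" using N by linarith
    then have one: "n = 1" "k = 1" by simp_all
    from one(1) have "petal_count = 1" by (simp add: petal_count_def)
    then show ?thesis by (simp only: \<open>petal_count = 1\<close>) (simp add: one)
  qed
  have "n * (k * (petal_count * (m ^ k * (k * m)))) = (n * k) * petal_count * k * m ^ (k + 1)"
    by (simp add: algebra_simps)
  also have "\<dots> \<le> ?N * ?N * ?N * m ^ (k + 1)"
    using petal_count_le N by (intro mult_le_mono) auto
  finally have "n * (k * (petal_count * (m ^ k * (k * m)))) \<le> ?N ^ 3 * m ^ (k + 1)"
    by (simp only: power3_eq_cube)
  then have "digits_base ^ ?N * (n * (k * (petal_count * (m ^ k * (k * m))))) \<le>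
      digits_base ^ ?N * (?N ^ 3 * m ^ (k + 1))" by (rule mult_le_mono2)
  then have "real (digits_base ^ ?N * (n * (k * (petal_count * (m ^ k * (k * m)))))) \<le>
      real (digits_base ^ ?N * (?N ^ 3 * m ^ (k + 1)))" by (rule of_nat_mono)
  also have "\<dots> = (real ?N ^ 3 * real digits_base ^ ?N) * real m ^ (k + 1)"
    by (simp only: of_nat_mult of_nat_power ac_simps)
  also have "\<dots> \<le> (1000 * real ?N ^ (2 * ?N)) * real m ^ (k + 1)"
    by (rule mult_right_mono[OF base]) simp
  finally have "8000 * real (digits_base ^ ?N * (n * (k * (petal_count * (m ^ k * (k * m)))))) \<le>
      8000 * (1000 * real ?N ^ (2 * ?N) * real m ^ (k + 1))" by (rule mult_left_mono) simp
  moreover have "8000 * (1000 * a * b) = 8000000 * a * b" for a b :: real by simp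
  ultimately show ?thesis by (simp only: of_nat_mult of_nat_numeral)
qed

end

lemma wp_program_trivial:
  assumes "num_cands I \<le> k"
  shows "wp program (\<lambda>t s'. t \<le> 20 \<and> s' ''out'' 0 = 1) (input_store k I)"
proof -
  have "\<not> bval (Less (Val ''k'') (Val ''m'')) (input_store k I)"
    using assms by (simp add: input_store_def scalar_def Let_def)
  then show ?thesis unfolding program_def
    by (intro wp_Cond wp_Assign) (simp_all add: update_apply)
qed

lemma program_correct:
  assumes k: "1 \<le> k" and I: "valid_instance I"
  shows "\<exists>t s'. (\<forall>\<omega>. exec program (input_store k I) \<omega> t s' \<omega>) \<and>
     s' ''out'' 0 = of_bool (approval_swap_bribery k I) \<and>
     real t \<le> 8000000 * real (num_votes I * k) ^ (2 * (num_votes I * k)) * real (num_cands I) ^ (k + 1)"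
proof (cases "k < num_cands I")
  case True
  interpret bribery k I by unfold_locales (use k I True in auto)
  from wp_program obtain t s' where "\<forall>\<omega>. exec program (input_store k I) \<omega> t s' \<omega>"
    "s' ''out'' 0 = of_bool (approval_swap_bribery k I)"
    and t: "t \<le> 8000 * (digits_base ^ (n * k) * (n * (k * (petal_count * (m ^ k * (k * m))))))"
    unfolding wp_def by blast
  moreover have "real t \<le> 8000000 * real (n * k) ^ (2 * (n * k)) * real m ^ (k + 1)"
    using of_nat_mono[OF t] time_bound by (rule order_trans)
  ultimately show ?thesis by blast
next
  case False
  let ?n = "num_votes I" and ?m = "num_cands I"
  have "is_election {..<?m} (votes I)" "preferred I < ?m" "votes I \<noteq> []"
    using I by (simp_all add: valid_instance_def)
  then have ans: "approval_swap_bribery k I" and pos: "1 \<le> ?m" "1 \<le> ?n * k"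
    using swap_bribery_trivial[of "{..<?m}" "votes I" "preferred I" k] False k
    by (auto simp: approval_swap_bribery_def num_votes_def Suc_le_eq)
  obtain t s' where t: "\<forall>\<omega>. exec program (input_store k I) \<omega> t s' \<omega>" "t \<le> 20" "s' ''out'' 0 = 1"
    using wp_program_trivial[of I k] False unfolding wp_def by (auto simp: not_less)
  have "1 \<le> real (?n * k) ^ (2 * (?n * k))" "1 \<le> real ?m ^ (k + 1)"
    by (rule one_le_power, use pos in \<open>simp del: of_nat_mult\<close>)+
  then have "1 * 1 \<le> real (?n * k) ^ (2 * (?n * k)) * real ?m ^ (k + 1)" by (intro mult_mono) auto
  then have "real t \<le> 8000000 * real (?n * k) ^ (2 * (?n * k)) * real ?m ^ (k + 1)"
    using t(2) by simp
  then show ?thesis using t ans by auto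
qed

text \<open>Translates the exponent with logarithms into the power \<open>N ^ (2 * N)\<close> by
  which the time was bounded.\<close>

lemma log_powr:
  assumes "1 \<le> a" "1 \<le> b"
  shows "2 powr (2 * (log 2 (real a) + log 2 (real b)) * real a * real b) = real (a * b) ^ (2 * (a * b))"
proof -
  have "log 2 (real a) + log 2 (real b) = log 2 (real (a * b))"
    using assms by (simp add: log_mult)
  then have "2 powr (2 * (log 2 (real a) + log 2 (real b)) * real a * real b) =
      (2 powr log 2 (real (a * b))) powr real (2 * (a * b))"
    by (simp add: powr_powr ac_simps)
  also have "\<dots> = real (a * b) ^ (2 * (a * b))"
    using assms by (subst powr_realpow) auto
  finally show ?thesis .
qed

theorem theorem6:
  shows
    "(\<exists>prog (D :: real).
        \<forall>k I. 1 \<le> k \<and> valid_instance I \<longrightarrow>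
          (let n = real (num_votes I); m = real (num_cands I) in
            never_errs prog (input_store k I) (approval_swap_bribery k I) \<and>
            (AE \<omega> in coins. halts prog (input_store k I) \<omega>) \<and>
            expected_run_time prog (input_store k I)
              \<le> ennreal (2 powr (2 * (log 2 n + log 2 (real k)) * n * real k)
                          * (D * m ^ (k + 1)))))
     \<and>
     (\<exists>prog (D :: real) (E :: real). flip_free prog \<and>
        (\<forall>k I. 1 \<le> k \<and> valid_instance I \<longrightarrow>
          (let n = real (num_votes I); m = real (num_cands I) in
            never_errs prog (input_store k I) (approval_swap_bribery k I) \<and>
            (\<forall>\<omega>. halts prog (input_store k I) \<omega>) \<and>
            (num_cands I \<ge> 2 \<longrightarrow>
              (\<forall>\<omega>. run_time prog (input_store k I) \<omega>
                \<le> ennreal (2 powr (E * ((log 2 n + log 2 (real k)) * n * real k))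
                            * (D * (m ^ (k + 1) * log 2 m))))))))"
proof -
  let ?D = "8000000 :: real"
  have main: "never_errs program (input_store k I) (approval_swap_bribery k I) \<and>
      (\<forall>\<omega>. halts program (input_store k I) \<omega>) \<and>
      (\<forall>\<omega>. run_time program (input_store k I) \<omega> \<le>
        ennreal (2 powr (2 * (log 2 (real (num_votes I)) + log 2 (real k)) * real (num_votes I) * real k)
          * (?D * real (num_cands I) ^ (k + 1))))"
    if k: "1 \<le> k" and I: "valid_instance I" for k I
  proof -
    obtain t s' where ex: "\<And>\<omega>. exec program (input_store k I) \<omega> t s' \<omega>"
      and out: "s' ''out'' 0 = of_bool (approval_swap_bribery k I)"
      and t: "real t \<le> ?D * real (num_votes I * k) ^ (2 * (num_votes I * k)) * real (num_cands I) ^ (k + 1)"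
      using program_correct[OF k I] by blast
    have n: "1 \<le> num_votes I" using I by (simp add: valid_instance_def num_votes_def Suc_le_eq)
    have "run_time program (input_store k I) \<omega> = ennreal (real t)" for \<omega>
    proof -
      have "(THE t. \<exists>s' \<omega>'. exec program (input_store k I) \<omega> t s' \<omega>') = t"
        using ex exec_deterministic by blast
      moreover have "\<exists>t s' \<omega>'. exec program (input_store k I) \<omega> t s' \<omega>'" using ex by blast
      ultimately show ?thesis unfolding run_time_def by (simp add: ennreal_of_nat_eq_real_of_nat)
    qed
    moreover have "ennreal (real t) \<le>
        ennreal (2 powr (2 * (log 2 (real (num_votes I)) + log 2 (real k)) * real (num_votes I) * real k)
          * (?D * real (num_cands I) ^ (k + 1)))"
      using t unfolding log_powr[OF n k] by (intro ennreal_leI) (simp only: ac_simps)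
    moreover have "never_errs program (input_store k I) (approval_swap_bribery k I)"
      unfolding never_errs_def
    proof (intro allI impI)
      fix \<omega> u s'' \<omega>'
      assume "exec program (input_store k I) \<omega> u s'' \<omega>'"
      then have "s'' = s'" using exec_deterministic[OF ex] by blast
      then show "s'' ''out'' 0 = of_bool (approval_swap_bribery k I)" using out by simp
    qed
    moreover have "halts program (input_store k I) \<omega>" for \<omega> unfolding halts_def using ex by blast
    ultimately show ?thesis by simp
  qed
  interpret prob_space coins unfolding coins_def
    by (intro prob_space.prob_space_stream_space prob_space_measure_pmf)
  \<comment> \<open>A bound on every run bounds the mean, because \<open>coins\<close> is a
    probability measure.\<close>
  have expected: "expected_run_time program s \<le> b" if "\<forall>\<omega>. run_time program s \<omega> \<le> b" for s b
  proof -
    have "expected_run_time program s \<le> (\<integral>\<^sup>+ \<omega>. b \<partial>coins)"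
      unfolding expected_run_time_def using that by (intro nn_integral_mono) simp
    then show ?thesis by (simp add: emeasure_space_1)
  qed
  show ?thesis
  proof (rule conjI, goal_cases)
    case 1
    show ?case
    proof (intro exI[of _ program] exI[of _ ?D] allI impI)
      fix k :: nat and I :: bribery_instance
      assume "1 \<le> k \<and> valid_instance I"
      then show "let n = real (num_votes I); m = real (num_cands I) in
            never_errs program (input_store k I) (approval_swap_bribery k I) \<and>
            (AE \<omega> in coins. halts program (input_store k I) \<omega>) \<and>
            expected_run_time program (input_store k I)
              \<le> ennreal (2 powr (2 * (log 2 n + log 2 (real k)) * n * real k)
                          * (?D * m ^ (k + 1)))"
        using main[of k I] expected unfolding Let_def by simp
    qed
  next
    case 2
    show ?case
    proof (rule exI[of _ program], rule exI[of _ ?D], rule exI[of _ 2],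
        rule conjI[OF flip_free_program], intro allI impI, goal_cases)
      case (1 k I)
      let ?A = "2 powr (2 * (log 2 (real (num_votes I)) + log 2 (real k)) * real (num_votes I) * real k)"
      let ?X = "real (num_cands I) ^ (k + 1)"
      have "?A * (?D * ?X) \<le> ?A * (?D * (?X * log 2 (real (num_cands I))))" if "2 \<le> num_cands I"
      proof -
        \<comment> \<open>From two candidates on, the factor \<open>log m\<close> is at least 1, so
          the bound already proved implies the one with this factor.\<close>
        have "1 \<le> log 2 (real (num_cands I))" using that by simp
        then have "?X * 1 \<le> ?X * log 2 (real (num_cands I))" by (intro mult_left_mono) simp_all
        then show ?thesis by (intro mult_left_mono) simp_all
      qed
      then have "ennreal (?A * (?D * ?X)) \<le> ennreal (?A * (?D * (?X * log 2 (real (num_cands I)))))"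
        if "2 \<le> num_cands I" using that by (intro ennreal_leI)
      moreover have run: "run_time program (input_store k I) \<omega> \<le> ennreal (?A * (?D * ?X))" for \<omega>
        using main[of k I] 1 by blast
      ultimately have le: "run_time program (input_store k I) \<omega> \<le>
          ennreal (?A * (?D * (?X * log 2 (real (num_cands I)))))" if "2 \<le> num_cands I" for \<omega>
        using that by (blast intro: order_trans)
      have assoc: "2 * ((log 2 (real (num_votes I)) + log 2 (real k)) * real (num_votes I) * real k) =
        2 * (log 2 (real (num_votes I)) + log 2 (real k)) * real (num_votes I) * real k"
        by (simp only: mult.assoc)
      show ?case unfolding Let_def assoc using main[of k I] 1 le by blast
    qed
  qed
qed

end
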